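(* For every integer $k\ge2$ and every integer $p\ge0$, $$\sum_{\substack{j_1+\cdots+j_{k+1}=p+k+1\\ j_1,\dots,j_{k+1}\ge1}}T(\overline{j_1},j_2,\dots,j_{k-1},\overline{j_k},\overline{j_{k+1}})=(-1)^kT(\overline1,\{1\}_{k-2},\overline1,\overline{p+1})+(-1)^k\sum_{j=1}^k(-1)^jT(\overline{j})\,T(\{1\}_{p-1},\overline1,\overline{k-j+1}),$$ where $\{1\}_n$ denotes $1$ repeated $n$ times and, when $p=0$, the sequence $(\{1\}_{-1},\overline1)$ is empty (so the last factor is $T(\overline{k-j+1})$).
   Context: For positive integers $k_1,\dots,k_r$ and signs $\sigma_1,\dots,\sigma_r\in\{\pm1\}$ with $(k_r,\sigma_r)\ne(1,1)$, define $$T(k_1,\dots,k_r;\sigma_1,\dots,\sigma_r):=2^r\sum_{0<n_1<\cdots<n_r}\frac{\sigma_1^{n_1}\sigma_2^{n_2}\cdots\sigma_r^{n_r}}{(2n_1-1)^{k_1}(2n_2-2)^{k_2}\cdots(2n_r-r)^{k_r}}$$ (conditionally convergent sums are limits as $N\to\infty$ of the sums over $n_r\le N$). The signs are indicated by placing a bar over $k_j$ exactly when $\sigma_j=-1$; e.g. $T(\bar2,3,\bar1)=T(2,3,1;-1,1,-1)$. For $k=2$ the summand on the left is $T(\overline{j_1},\overline{j_2},\overline{j_3})$. *)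

theory Defs
  imports "HOL-Analysis.Analysis"
begin

text \<open>
  An argument list \<open>[(k\<^sub>1, \<sigma>\<^sub>1), \<dots>, (k\<^sub>r, \<sigma>\<^sub>r)]\<close> pairs every exponent with its sign.
  A barred entry is one with sign \<open>-1\<close>.
\<close>

abbreviation plain :: "nat \<Rightarrow> nat \<times> int" where
  "plain k \<equiv> (k, 1)"

abbreviation barred :: "nat \<Rightarrow> nat \<times> int" where
  "barred k \<equiv> (k, -1)"

definition incr_indices :: "nat \<Rightarrow> nat \<Rightarrow> nat list set" where
  "incr_indices r N = {ns. length ns = r \<and> sorted_wrt (<) ns \<and> set ns \<subseteq> {1..N}}"

text \<open>
  List positions start at 0, so position \<open>i\<close> holds \<open>n\<^bsub>i+1\<^esub>\<close> and contributes the
  denominator \<open>2 n\<^bsub>i+1\<^esub> - (i + 1)\<close>. It is at least 1, since \<open>n\<^bsub>i+1\<^esub> \<ge> i + 1\<close>.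
\<close>

definition T_partial :: "(nat \<times> int) list \<Rightarrow> nat \<Rightarrow> real" where
  "T_partial ks N =
     2 ^ length ks *
     (\<Sum>ns \<in> incr_indices (length ks) N.
        \<Prod>i<length ks.
          real_of_int (snd (ks ! i)) ^ (ns ! i) /
          (2 * real (ns ! i) - real (i + 1)) ^ fst (ks ! i))"

text \<open>
  Meaningful for nonempty lists with positive exponents, signs \<open>1\<close> or \<open>-1\<close>, and last
  entry different from \<open>plain 1\<close>.
\<close>

definition T_val :: "(nat \<times> int) list \<Rightarrow> real" where
  "T_val ks = lim (T_partial ks)"

definition compositions :: "nat \<Rightarrow> nat \<Rightarrow> nat list set" where
  "compositions m w = {js. length js = m \<and> (\<forall>j \<in> set js. 1 \<le> j) \<and> sum_list js = w}"

end

theory Submission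
  imports Defs "HOL-Real_Asymp.Real_Asymp"
begin

text \<open>
  Write \<open>\<omega>\<^sub>0 = dx/x\<close>, \<open>\<omega>\<^sub>+ = 2dx/(1 - x\<^sup>2)\<close>, \<open>\<omega>\<^sub>- = 2dx/(1 + x\<^sup>2)\<close>. Replacing the last factor of the
  summand by \<open>x\<close> to the power \<open>2n\<^sub>r - r\<close> turns a T-value into a power series, and differentiating that
  series peels off one form at a time. Up to a sign, a T-value is therefore an iterated integral
  over \<open>0 < t\<^sub>1 < t\<^sub>2 < \<dots> < 1\<close>: each entry \<open>(k\<^sub>i, \<sigma>\<^sub>i)\<close> contributes one form \<open>\<omega>\<^sub>\<plusminus>\<close>, whose sign is the
  product \<open>\<sigma>\<^sub>i \<sigma>\<^bsub>i+1\<^esub> \<dots> \<sigma>\<^sub>r\<close>, followed by \<open>k\<^sub>i - 1\<close> copies of \<open>\<omega>\<^sub>0\<close> (\<open>T_val_eq_iter_val\<close>).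
  The sign pattern on the left-hand side gives the words that start with \<open>\<omega>\<^sub>-\<close> and continue with
  \<open>\<omega>\<^sub>+, \<dots>, \<omega>\<^sub>+, \<omega>\<^sub>-\<close> (here \<open>\<omega>\<^sub>+\<close> occurs \<open>k - 1\<close> times) into which \<open>p\<close> letters \<open>\<omega>\<^sub>0\<close> are inserted in
  all possible ways.

  The substitution \<open>x \<mapsto> (1 - x)/(1 + x)\<close> reverses the interval, exchanges \<open>\<omega>\<^sub>0\<close> with \<open>\<omega>\<^sub>+\<close> and fixes
  \<open>\<omega>\<^sub>-\<close>, all up to the orientation sign. Hence a word and its reversed, exchanged word have the same value
  (\<open>iter_val_dual\<close>). After this duality the left-hand side is the sum over all shuffles of
  the word of \<open>F(x) = \<integral> \<omega>\<^sub>- \<omega>\<^sub>0 \<dots> \<omega>\<^sub>0\<close> with \<open>\<omega>\<^sub>+ \<dots> \<omega>\<^sub>+\<close> (\<open>sum_compositions_fill_gaps\<close>), closed off by an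
  outermost \<open>\<omega>\<^sub>-\<close>. The shuffle product (\<open>iter_int_shuffle\<close>) collapses it to the single integral of
  \<open>F(x) L(x)\<close> against \<open>\<omega>\<^sub>-\<close>, where \<open>L\<close> is the iterated integral of \<open>\<omega>\<^sub>+\<close> taken \<open>p\<close> times. Integrating by
  parts \<open>k\<close> times, always differentiating the factor that comes from \<open>F\<close>, strips the forms \<open>\<omega>\<^sub>0\<close> from \<open>F\<close>
  and moves them onto the other factor. The boundary terms are the products \<open>T(j\<close> barred\<open>) T(\<dots>)\<close>, and
  the integral that remains at the end is dual to the first term on the right
  (\<open>sum_iter_val_shuffles\<close>).

  Everything up to evaluation takes place in the ring of formal power series. Analysis enters
  in two places. Some of the series converge only conditionally at 1, so convergence is proved from
  a bound on the coefficients and Abel's theorem links the partial sums to the limit at 1. And in the proof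
  of duality, which shows that a sum of products has derivative 0, logarithmic divergence of one factor
  at an endpoint must be outweighed by the zero of the other one.
\<close>

section \<open>Abel summation\<close>

lemma convergent_real_bounded:
  fixes b :: "nat \<Rightarrow> real"
  assumes "b \<longlonglongrightarrow> l"
  shows "\<exists>K. \<forall>n. \<bar>b n\<bar> \<le> K"
  using convergent_imp_Bseq[OF convergentI[OF assms]] by (auto simp: Bseq_def)

text \<open>
  The weights \<open>(1 - x) x\<^sup>n\<close> add up to 1 and, as \<open>x\<close> tends to 1, the weight of every initial segment
  vanishes. This serves twice: applied to partial sums it gives Abel's limit theorem, applied to the
  coefficients of a series it bounds the growth of the series near 1.
\<close>

lemma abel_mean_tendsto:
  fixes a :: "nat \<Rightarrow> real"
  assumes lim: "a \<longlonglongrightarrow> L"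
  shows "((\<lambda>x. (1 - x) * (\<Sum>n. a n * x ^ n)) \<longlongrightarrow> L) (at_left 1)"
proof -
  have sm: "summable (\<lambda>n. b n * x ^ n)" if b: "b \<longlonglongrightarrow> l" and "0 < x" "x < 1"
    for b :: "nat \<Rightarrow> real" and l x :: real
  proof -
    obtain K where K: "\<And>n. \<bar>b n\<bar> \<le> K"
      using convergent_real_bounded[OF b] by blast
    show ?thesis
      by (rule summable_comparison_test'[of "\<lambda>n. K * x ^ n" 0])
         (use that K in \<open>auto simp: abs_mult power_abs intro!: mult_mono\<close>)
  qed
  have null: "((\<lambda>x. (1 - x) * (\<Sum>n. b n * x ^ n)) \<longlongrightarrow> 0) (at_left 1)"
    if b: "b \<longlonglongrightarrow> 0" for b :: "nat \<Rightarrow> real"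
  proof (rule tendstoI)
    fix e :: real assume "e > 0"
    then obtain N where N: "\<And>n. n \<ge> N \<Longrightarrow> \<bar>b n\<bar> < e / 2"
      using LIMSEQ_D[OF b, of "e / 2"] by auto
    define C where "C = (\<Sum>n<N. \<bar>b n\<bar>) + 1"
    have "C > 0" by (auto simp: C_def intro: add_nonneg_pos sum_nonneg)
    have "eventually (\<lambda>x. 1 - x < e / (2 * C)) (at_left 1)"
      using \<open>C > 0\<close> \<open>e > 0\<close> eventually_at_left_real[of "1 - e / (2 * C)" 1]
      by (auto elim!: eventually_mono)
    moreover have "eventually (\<lambda>x. x \<in> {0<..<1::real}) (at_left 1)"
      by (rule eventually_at_left_real) simp
    ultimately show "eventually (\<lambda>x. dist ((1 - x) * (\<Sum>n. b n * x ^ n)) 0 < e) (at_left 1)"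
    proof eventually_elim
      case (elim x)
      then have x: "0 < x" "x < 1" by auto
      let ?t = "\<lambda>n. b n * x ^ n"
      have s: "summable ?t" by (rule sm[OF b]) (use x in auto)
      have head: "\<bar>\<Sum>n<N. ?t n\<bar> \<le> C - 1"
      proof -
        have "\<bar>\<Sum>n<N. ?t n\<bar> \<le> (\<Sum>n<N. \<bar>b n\<bar>)"
          by (rule order.trans[OF sum_abs sum_mono])
             (use x in \<open>auto simp: abs_mult power_abs intro!: mult_left_le power_le_one\<close>)
        then show ?thesis by (simp add: C_def)
      qed
      have gs: "(\<lambda>n. e / 2 * x ^ n) sums (e / 2 * (1 / (1 - x)))"
        by (intro sums_mult geometric_sums) (use x in auto)
      have "\<bar>\<Sum>n. ?t (n + N)\<bar> \<le> (\<Sum>n. e / 2 * x ^ n)"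
      proof (rule norm_suminf_le[of "\<lambda>n. ?t (n + N)", unfolded real_norm_def])
        show "summable (\<lambda>n. e / 2 * x ^ n)" using gs by (rule sums_summable)
        show "\<bar>?t (n + N)\<bar> \<le> e / 2 * x ^ n" for n
        proof -
          have "x ^ (n + N) \<le> x ^ n" using x by (intro power_decreasing) auto
          moreover have "\<bar>b (n + N)\<bar> \<le> e / 2" using N[of "n + N"] by simp
          ultimately show ?thesis
            unfolding abs_mult using x \<open>e > 0\<close> by (intro mult_mono) auto
        qed
      qed
      also have "\<dots> = e / 2 * (1 / (1 - x))" using gs by (rule sums_unique[symmetric])
      finally have tail: "\<bar>\<Sum>n. ?t (n + N)\<bar> \<le> e / 2 * (1 / (1 - x))" .
      have "(\<Sum>n. ?t n) = (\<Sum>n. ?t (n + N)) + (\<Sum>n<N. ?t n)"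
        by (rule suminf_split_initial_segment[OF s])
      then have "\<bar>\<Sum>n. ?t n\<bar> \<le> e / 2 * (1 / (1 - x)) + (C - 1)"
        using head tail by linarith
      then have "(1 - x) * \<bar>\<Sum>n. ?t n\<bar> \<le> (1 - x) * (e / 2 * (1 / (1 - x)) + (C - 1))"
        using x by (intro mult_left_mono) auto
      also have "\<dots> = e / 2 + (1 - x) * (C - 1)" using x by (simp add: field_simps)
      also have "\<dots> < e / 2 + (1 - x) * C" using x by simp
      also have "\<dots> \<le> e / 2 + e / (2 * C) * C"
        using elim(1) \<open>C > 0\<close> by (intro add_left_mono mult_right_mono) auto
      also have "\<dots> = e" using \<open>C > 0\<close> by simp
      finally show ?case using x by (simp add: dist_real_def abs_mult)
    qed
  qed
  \<comment> \<open>The constant sequence \<open>L\<close> has mean \<open>L\<close>, so only null sequences matter.\<close>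
  have ev: "eventually (\<lambda>x. (1 - x) * (\<Sum>n. a n * x ^ n)
          = (1 - x) * (\<Sum>n. (a n - L) * x ^ n) + L) (at_left (1::real))"
    using eventually_at_left_real[of 0 "1::real", OF zero_less_one]
  proof eventually_elim
    case (elim x)
    then have x: "0 < x" "x < 1" by auto
    have "(\<Sum>n. (a n - L) * x ^ n) = (\<Sum>n. a n * x ^ n) - (\<Sum>n. L * x ^ n)"
      unfolding left_diff_distrib
      by (rule suminf_diff[symmetric]) (use x in \<open>auto intro!: sm[OF lim] sm[OF tendsto_const]\<close>)
    also have "(\<Sum>n. L * x ^ n) = L * (1 / (1 - x))"
      by (rule sums_unique[symmetric], intro sums_mult geometric_sums) (use x in auto)
    finally show ?case using x by (simp add: field_simps)
  qed
  have "((\<lambda>x. (1 - x) * (\<Sum>n. (a n - L) * x ^ n) + L) \<longlongrightarrow> 0 + L) (at_left 1)"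
    by (intro tendsto_intros null) (use LIM_zero[OF lim] in simp)
  then show ?thesis unfolding tendsto_cong[OF ev] by simp
qed

lemma abel_limit:
  fixes c :: "nat \<Rightarrow> real"
  assumes "summable c"
  shows "((\<lambda>x. \<Sum>n. c n * x ^ n) \<longlongrightarrow> (\<Sum>n. c n)) (at_left 1)"
proof -
  let ?s = "\<lambda>n. \<Sum>i\<le>n. c i"
  have s: "?s \<longlonglongrightarrow> (\<Sum>n. c n)" by (rule summable_LIMSEQ'[OF assms])
  have ev: "eventually (\<lambda>x. (\<Sum>n. c n * x ^ n) = (1 - x) * (\<Sum>n. ?s n * x ^ n)) (at_left (1::real))"
    using eventually_at_left_real[of 0 "1::real", OF zero_less_one]
  proof eventually_elim
    case (elim x)
    then have x: "0 < x" "x < 1" by auto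
    obtain K where K: "\<And>n. \<bar>c n\<bar> \<le> K"
      using convergent_real_bounded[OF summable_LIMSEQ_zero[OF assms]] by blast
    have "summable (\<lambda>n. \<bar>c n * x ^ n\<bar>)"
      by (rule summable_comparison_test'[of "\<lambda>n. K * x ^ n" 0])
         (use x K in \<open>auto simp: abs_mult power_abs intro!: mult_mono\<close>)
    moreover have "summable (\<lambda>n. \<bar>x ^ n\<bar>)" using x by (simp add: power_abs)
    \<comment> \<open>Multiplying by the geometric series replaces coefficients by their partial sums.\<close>
    ultimately have "(\<Sum>n. c n * x ^ n) * (\<Sum>n. x ^ n)
        = (\<Sum>n. \<Sum>i\<le>n. c i * x ^ i * x ^ (n - i))"
      by (intro Cauchy_product) (simp_all only: real_norm_def)
    also have "\<dots> = (\<Sum>n. ?s n * x ^ n)"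
      by (intro suminf_cong)
         (auto simp: sum_distrib_right mult.assoc simp flip: power_add intro!: sum.cong)
    also have "(\<Sum>n. x ^ n) = 1 / (1 - x)" using x by (intro suminf_geometric) auto
    finally show ?case using x by (simp add: field_simps)
  qed
  show ?thesis unfolding tendsto_cong[OF ev] by (rule abel_mean_tendsto[OF s])
qed


section \<open>Words in three differential forms\<close>

unbundle no vec_syntax
unbundle fps_syntax

text \<open>
  The constructors stand for \<open>dx/x\<close>, \<open>2dx/(1 - x\<^sup>2)\<close> and \<open>2dx/(1 + x\<^sup>2)\<close>.
\<close>

datatype form = W0 | WP | WM

text \<open>
  For \<open>W0\<close> this is division by \<open>x\<close> only if the constant term vanishes; otherwise the constant term is
  dropped. Words whose innermost form is not \<open>W0\<close> never meet the second case.
\<close>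

fun form_mult :: "form \<Rightarrow> real fps \<Rightarrow> real fps" where
  "form_mult W0 f = fps_shift 1 f"
| "form_mult WP f = 2 * inverse (1 - fps_X ^ 2) * f"
| "form_mult WM f = 2 * inverse (1 + fps_X ^ 2) * f"

definition prim :: "form \<Rightarrow> real fps \<Rightarrow> real fps" where
  "prim c f = fps_integral0 (form_mult c f)"

text \<open>
  The head of the list is the outermost form, that is, the one with the largest integration variable.
\<close>

primrec iter_int :: "form list \<Rightarrow> real fps" where
  "iter_int [] = 1"
| "iter_int (c # w) = prim c (iter_int w)"

lemma prim_nth_0 [simp]: "prim c f $ 0 = 0"
  by (simp add: prim_def)

lemma prim_nth_Suc: "prim c f $ Suc n = form_mult c f $ n / (n + 1)"
  by (simp add: prim_def field_simps)

lemma deriv_prim [simp]: "fps_deriv (prim c f) = form_mult c f"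
  by (simp add: prim_def fps_deriv_fps_integral)

lemma iter_int_nth_0: "iter_int w $ 0 = (if w = [] then 1 else 0)"
  by (cases w) auto

lemma fps_shift_1_mult:
  fixes f g :: "real fps" assumes "f $ 0 = 0" shows "fps_shift 1 (f * g) = fps_shift 1 f * g"
proof (cases "f = 0")
  case False
  then have "1 \<le> subdegree f" using assms by (metis One_nat_def Suc_leI gr0I nth_subdegree_nonzero)
  then show ?thesis by (rule fps_shift_mult_right_noncomm)
qed simp

lemma form_mult_mult:
  assumes "c = W0 \<Longrightarrow> f $ 0 = 0"
  shows "form_mult c (f * g) = form_mult c f * g"
proof (cases c)
  case W0 
  then show ?thesis using assms fps_shift_1_mult[of f g] by simp
qed (simp_all add: mult.assoc)

text \<open>
  The product rule for two primitives, in integrated form. Both the shuffle product and the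
  integration by parts below are iterations of this identity.
\<close>

lemma prim_mult_prim:
  assumes "c = W0 \<Longrightarrow> f $ 0 = 0" "d = W0 \<Longrightarrow> g $ 0 = 0"
  shows "prim c f * prim d g = prim c (f * prim d g) + prim d (prim c f * g)"
proof -
  have "form_mult d (prim c f * g) = prim c f * form_mult d g"
    using form_mult_mult[of d g "prim c f"] assms by (simp add: mult.commute)
  then have "fps_deriv (prim c f * prim d g) = fps_deriv (prim c (f * prim d g) + prim d (prim c f * g))"
    using form_mult_mult[of c f "prim d g"] assms by (simp add: algebra_simps)
  then show ?thesis by (subst (asm) fps_deriv_eq_iff) simp
qed

lemma prim_add: "prim c (f + g) = prim c f + prim c g"
  by (cases c) (simp_all add: prim_def fps_shift_add fps_integral0_add distrib_left)

lemma prim_sum: "prim c (\<Sum>x\<in>A. f x) = (\<Sum>x\<in>A. prim c (f x))"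
proof (induction A rule: infinite_finite_induct)
  case (insert x F)
  then show ?case by (simp add: prim_add)
qed (cases c; simp add: prim_def fps_integral0_zero)+

text \<open>
  \<open>dx/x\<close> cannot be integrated from 0, so it must not be the innermost form.
\<close>

abbreviation regular :: "form list \<Rightarrow> bool" where
  "regular w \<equiv> w \<noteq> [] \<longrightarrow> last w \<noteq> W0"

text \<open>
  Merging the two chains of integration variables in all possible orders. The library's
  \<open>shuffles\<close> is a set, so it counts each merged word only once. Disjoint alphabets make every word
  arise from one merging only.
\<close>

lemma iter_int_shuffle:
  assumes "regular u" "regular v" "set u \<inter> set v = {}"
  shows "iter_int u * iter_int v = (\<Sum>w \<in> shuffles u v. iter_int w)"
  using assms
proof (induction u v rule: shuffles.induct)
  case (3 c u d v)
  have reg: "c = W0 \<Longrightarrow> iter_int u $ 0 = 0" "d = W0 \<Longrightarrow> iter_int v $ 0 = 0"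
    using "3.prems" by (auto simp: iter_int_nth_0)
  have "iter_int (c # u) * iter_int (d # v)
      = prim c (iter_int u * iter_int (d # v)) + prim d (iter_int (c # u) * iter_int v)"
    using prim_mult_prim[of c "iter_int u" d "iter_int v"] reg by simp
  also have "iter_int u * iter_int (d # v) = (\<Sum>w \<in> shuffles u (d # v). iter_int w)"
    by (rule "3.IH") (use "3.prems" in \<open>auto split: if_splits\<close>)
  also have "iter_int (c # u) * iter_int v = (\<Sum>w \<in> shuffles (c # u) v. iter_int w)"
    by (rule "3.IH") (use "3.prems" in \<open>auto split: if_splits\<close>)
  also have "prim c (\<Sum>w \<in> shuffles u (d # v). iter_int w) + prim d (\<Sum>w \<in> shuffles (c # u) v. iter_int w)
      = (\<Sum>w \<in> (#) c ` shuffles u (d # v). iter_int w) + (\<Sum>w \<in> (#) d ` shuffles (c # u) v. iter_int w)"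
    by (simp add: prim_sum sum.reindex)
  also have "\<dots> = (\<Sum>w \<in> shuffles (c # u) (d # v). iter_int w)"
    unfolding shuffles.simps
    by (rule sum.union_disjoint[symmetric]) (use "3.prems" in auto)
  finally show ?case .
qed simp_all

section \<open>Convergence at the endpoint\<close>

fun form_sign :: "form \<Rightarrow> real" where
  "form_sign W0 = 0" | "form_sign WP = 1" | "form_sign WM = -1"

text \<open>
  This form of the definition is a two-step recursion on coefficients, and it can be
  evaluated at a point without any information on the radius of the inverse.
\<close>

lemma form_mult_clear_denominator:
  assumes "c \<noteq> W0"
  shows "(1 - fps_const (form_sign c) * fps_X ^ 2) * form_mult c f = 2 * f"
proof -
  let ?q = "1 - fps_const (form_sign c) * fps_X ^ 2 :: real fps"
  have "form_mult c f = 2 * (inverse ?q * f)"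
    using assms by (cases c) (simp_all flip: fps_const_neg)
  then have "?q * form_mult c f = 2 * ((inverse ?q * ?q) * f)"
    by (simp add: algebra_simps)
  then show ?thesis by (subst (asm) inverse_mult_eq_1) auto
qed

lemma form_mult_nth_rec:
  assumes "c \<noteq> W0"
  shows "form_mult c f $ 0 = 2 * f $ 0"
    and "form_mult c f $ Suc 0 = 2 * f $ Suc 0"
    and "form_mult c f $ Suc (Suc n) = form_sign c * form_mult c f $ n + 2 * f $ Suc (Suc n)"
proof -
  have co: "form_mult c f $ m - form_sign c * (if m < 2 then 0 else form_mult c f $ (m - 2)) = 2 * f $ m" for m
    using arg_cong[OF form_mult_clear_denominator[OF assms], of "\<lambda>g. g $ m"]
    by (simp add: left_diff_distrib mult.assoc fps_X_power_mult_nth)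
  show "form_mult c f $ 0 = 2 * f $ 0" "form_mult c f $ Suc 0 = 2 * f $ Suc 0"
    "form_mult c f $ Suc (Suc n) = form_sign c * form_mult c f $ n + 2 * f $ Suc (Suc n)"
    using co[of 0] co[of "Suc 0"] co[of "Suc (Suc n)"] by auto
qed

lemma form_mult_nth_bound:
  assumes "c \<noteq> W0"
  shows "\<bar>form_mult c f $ n\<bar> \<le> 2 * (\<Sum>i\<le>n. \<bar>f $ i\<bar>)"
proof (induction n rule: induct_nat_012)
  case (ge2 n)
  have "\<bar>form_sign c\<bar> \<le> 1" by (cases c) auto
  then have "\<bar>form_sign c * form_mult c f $ n\<bar> \<le> \<bar>form_mult c f $ n\<bar>"
    unfolding abs_mult by (rule mult_left_le_one_le[rotated 2]) auto
  then show ?case using ge2 form_mult_nth_rec(3)[OF assms, of f n] by (simp add: distrib_left)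
qed (use form_mult_nth_rec[OF assms, of f] in \<open>auto simp: abs_mult\<close>)

lemma sum_inverse_sqrt_le: "(\<Sum>i\<le>n. 1 / sqrt (real i + 1)) \<le> 2 * sqrt (real n + 1)"
proof (induction n)
  case (Suc n)
  define a b where "a = sqrt (real n + 1)" and "b = sqrt (real n + 2)"
  have ab: "0 < a" "a \<le> b" "b * b - a * a = 1" by (auto simp: a_def b_def)
  have "1 \<le> (b - a) * (2 * b)"
    using mult_left_mono[of "b + a" "2 * b" "b - a"] ab by (simp add: algebra_simps)
  then have "1 / b \<le> 2 * b - 2 * a" using ab by (simp add: field_simps)
  then show ?case using Suc by (simp add: a_def b_def add.commute)
qed simp

text \<open>
  The coefficients of iterated integrals are in fact bounded by a power of the logarithm over \<open>n\<close>. The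
  cruder rate \<open>1/\<surd>n\<close> is still preserved by taking primitives, because
  \<open>\<Sum>\<^bsub>i\<le>n\<^esub> 1/\<surd>i\<close> is of order \<open>\<surd>n\<close>, and it is enough for convergence.
\<close>

definition sqrt_decay :: "real fps \<Rightarrow> real \<Rightarrow> bool" where
  "sqrt_decay f C \<longleftrightarrow> C \<ge> 0 \<and> (\<forall>n. \<bar>f $ n\<bar> \<le> C / sqrt (real n + 1))"

lemma form_mult_nth_sqrt:
  assumes "c \<noteq> W0" "sqrt_decay f C"
  shows "\<bar>form_mult c f $ n\<bar> \<le> 4 * C * sqrt (real n + 1)"
proof -
  have "(\<Sum>i\<le>n. \<bar>f $ i\<bar>) \<le> (\<Sum>i\<le>n. C * (1 / sqrt (real i + 1)))"
    using assms by (intro sum_mono) (auto simp: sqrt_decay_def)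
  also have "\<dots> \<le> C * (2 * sqrt (real n + 1))"
    unfolding sum_distrib_left[symmetric]
    using assms by (intro mult_left_mono sum_inverse_sqrt_le) (auto simp: sqrt_decay_def)
  finally show ?thesis using form_mult_nth_bound[OF assms(1), of f n] by simp
qed

lemma sqrt_decay_prim:
  assumes "sqrt_decay f C"
  shows "sqrt_decay (prim c f) (8 * C)"
  unfolding sqrt_decay_def
proof (intro conjI allI)
  have C: "C \<ge> 0" and f: "\<And>n. \<bar>f $ n\<bar> \<le> C / sqrt (real n + 1)"
    using assms by (auto simp: sqrt_decay_def)
  show "8 * C \<ge> 0" using C by simp
  fix n
  show "\<bar>prim c f $ n\<bar> \<le> 8 * C / sqrt (real n + 1)"
  proof (cases n)
    case (Suc m)
    show ?thesis
    proof (cases "c = W0")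
      case True
      have "\<bar>f $ n\<bar> / real n \<le> \<bar>f $ n\<bar>" using Suc by (simp add: field_simps mult_left_le)
      also note f[of n]
      also have "C / sqrt (real n + 1) \<le> 8 * C / sqrt (real n + 1)"
        using C by (intro divide_right_mono) auto
      finally show ?thesis using True Suc by (simp add: prim_nth_Suc add.commute)
    next
      case False
      define a where "a = sqrt (real m + 1)"
      have a: "a > 0" "a * a = real m + 1" by (auto simp: a_def)
      have "sqrt (real m + 2) \<le> sqrt (4 * (real m + 1))" by (rule real_sqrt_le_mono) simp
      also have "\<dots> = 2 * a" unfolding real_sqrt_mult a_def by simp
      finally have le: "sqrt (real m + 2) \<le> 2 * a" .
      have "\<bar>prim c f $ n\<bar> = \<bar>form_mult c f $ m\<bar> / (a * a)"
        unfolding a(2) by (simp add: Suc prim_nth_Suc add.commute)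
      also have "\<dots> \<le> 4 * C * a / (a * a)"
        using form_mult_nth_sqrt[OF False assms, of m] by (intro divide_right_mono) (auto simp: a_def)
      also have "\<dots> = 8 * C / (2 * a)" using a(1) by simp
      also have "\<dots> \<le> 8 * C / sqrt (real m + 2)"
        using le C a(1) by (intro divide_left_mono) auto
      finally show ?thesis by (simp add: Suc add.commute)
    qed
  qed (use C in simp)
qed

lemma sqrt_decay_iter_int: "sqrt_decay (iter_int w) (8 ^ length w)"
proof (induction w)
  case Nil
  then show ?case by (auto simp: sqrt_decay_def)
next
  case (Cons c w)
  then show ?case using sqrt_decay_prim[of "iter_int w" "8 ^ length w" c] by simp
qed

lemma sqrt_decay_tendsto_0:
  assumes "sqrt_decay f C"
  shows "(\<lambda>n. f $ n) \<longlonglongrightarrow> 0"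
proof (rule Lim_null_comparison)
  show "eventually (\<lambda>n. norm (f $ n) \<le> C / sqrt (real n + 1)) sequentially"
    using assms by (simp add: sqrt_decay_def)
  show "(\<lambda>n. C / sqrt (real n + 1)) \<longlonglongrightarrow> 0" by real_asymp
qed

text \<open>
  Convergence of an alternating series: the indices of the nonzero coefficients of the series in question
  advance by 2, so that alternating neighbours are two places apart.
\<close>

lemma summable_pairsum:
  fixes c :: "nat \<Rightarrow> real"
  assumes "c \<longlonglongrightarrow> 0" "summable (\<lambda>n. c n + c (n + 2))"
  shows "summable c"
proof -
  have eq: "(\<Sum>i<N. c i) = ((\<Sum>i<N. c i + c (i + 2)) + c 0 + c 1 - c N - c (N + 1)) / 2" for N
    by (induction N) (auto simp: field_simps)
  have "c \<longlonglongrightarrow> 0" "(\<lambda>N. c (N + 1)) \<longlonglongrightarrow> 0"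
    using assms(1) LIMSEQ_ignore_initial_segment by blast+
  then have "(\<lambda>N. \<Sum>i<N. c i) \<longlonglongrightarrow> ((\<Sum>i. c i + c (i + 2)) + c 0 + c 1 - 0 - 0) / 2"
    unfolding eq by (intro tendsto_intros summable_LIMSEQ[OF assms(2)]) auto
  then show ?thesis by (auto simp: summable_def sums_def)
qed

lemma summable_inverse_three_halves: "summable (\<lambda>n. C / ((real n + 1) * sqrt (real n + 1)))"
proof -
  have "summable (\<lambda>n. real (Suc n) powr (- 3 / 2))"
    using summable_Suc_iff[of "\<lambda>n. real n powr (- 3 / 2)"] by (simp add: summable_real_powr_iff)
  moreover have "real (Suc n) powr (- 3 / 2) = 1 / ((real n + 1) * sqrt (real n + 1))" for n
  proof -
    have "real (Suc n) powr (- 3 / 2) = inverse (real (Suc n) powr (1 + 1 / 2))"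
      by (subst powr_minus[symmetric]) simp
    then show ?thesis
      unfolding powr_add by (simp add: powr_half_sqrt add.commute inverse_eq_divide)
  qed
  ultimately show ?thesis using summable_mult[of _ C] by fastforce
qed

text \<open>
  With outermost form \<open>dx/x\<close> a coefficient is divided by its index, which makes the series
  absolutely convergent. With \<open>2dx/(1 + x\<^sup>2)\<close> it alternates, and by the recursion of the coefficients
  the sum of two neighbours is of order \<open>n\<close> to the power \<open>-3/2\<close>.
\<close>

lemma summable_prim:
  assumes "c \<noteq> WP" "sqrt_decay f C"
  shows "summable (\<lambda>n. prim c f $ n)"
proof -
  have C: "C \<ge> 0" and f: "\<And>n. \<bar>f $ n\<bar> \<le> C / sqrt (real n + 1)"
    using assms by (auto simp: sqrt_decay_def)
  have f': "\<bar>f $ (n + k)\<bar> / real (n + k + 1) \<le> C / ((real n + 1) * sqrt (real n + 1))" for n k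
  proof -
    have "C / sqrt (real (n + k) + 1) \<le> C / sqrt (real n + 1)"
      using C by (intro divide_left_mono) auto
    then have "\<bar>f $ (n + k)\<bar> \<le> C / sqrt (real n + 1)" using f[of "n + k"] by simp
    then have "\<bar>f $ (n + k)\<bar> / real (n + k + 1) \<le> (C / sqrt (real n + 1)) / (real n + 1)"
      using C by (intro frac_le) auto
    then show ?thesis by (simp add: mult.commute)
  qed
  show ?thesis
  proof (cases c)
    case W0
    have "summable (\<lambda>n. prim c f $ Suc n)"
    proof (rule summable_comparison_test'[OF summable_inverse_three_halves[of C]])
      fix n
      have "\<bar>prim c f $ Suc n\<bar> = \<bar>f $ (n + 1)\<bar> / (real n + 1)"
        by (simp add: W0 prim_nth_Suc add.commute)
      also have "\<dots> \<le> (C / sqrt (real n + 1)) / (real n + 1)"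
      proof (intro divide_right_mono)
        have "C / sqrt (real (n + 1) + 1) \<le> C / sqrt (real n + 1)"
          using C by (intro divide_left_mono) auto
        then show "\<bar>f $ (n + 1)\<bar> \<le> C / sqrt (real n + 1)" using f[of "n + 1"] by simp
      qed auto
      finally show "norm (prim c f $ Suc n) \<le> C / ((real n + 1) * sqrt (real n + 1))"
        by (simp add: mult.commute)
    qed
    then show ?thesis by (subst (asm) summable_Suc_iff)
  next
    case WM
    let ?g = "form_mult c f"
    have "c \<noteq> W0" using WM by simp
    note gb = form_mult_nth_sqrt[OF this assms(2)] and rec = form_mult_nth_rec(3)[OF this, of f]
    show ?thesis
    proof (rule summable_pairsum)
      show "(\<lambda>n. prim c f $ n) \<longlonglongrightarrow> 0"
        by (rule sqrt_decay_tendsto_0[OF sqrt_decay_prim[OF assms(2)]])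
      have "summable (\<lambda>n. prim c f $ Suc n + prim c f $ (Suc n + 2))"
      proof (rule summable_comparison_test'[OF summable_inverse_three_halves[of "10 * C"]])
        fix n
        define a where "a = sqrt (real n + 1)"
        have a: "a > 0" "a * a = real n + 1" by (auto simp: a_def)
        \<comment> \<open>The recursion \<open>?g $ (n + 2) = - ?g $ n + 2 * f $ (n + 2)\<close> cancels the leading parts.\<close>
        have "prim c f $ Suc n + prim c f $ (Suc n + 2)
            = ?g $ n * (2 / ((real n + 1) * (real n + 3))) + 2 * (f $ (n + 2) / real (n + 2 + 1))"
        proof -
          have "?g $ (n + 2) = 2 * f $ (n + 2) - ?g $ n" using rec[of n] WM by simp
          then have "prim c f $ Suc n + prim c f $ (Suc n + 2)
              = ?g $ n / (real n + 1) + (2 * f $ (n + 2) - ?g $ n) / (real n + 3)"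
            by (simp add: prim_nth_Suc add.commute)
          also have "\<dots> = ?g $ n * (1 / (real n + 1) - 1 / (real n + 3)) + 2 * (f $ (n + 2) / (real n + 3))"
            by (simp add: algebra_simps diff_divide_distrib)
          also have "1 / (real n + 1) - 1 / (real n + 3) = 2 / ((real n + 1) * (real n + 3))"
            by (simp add: field_simps)
          finally show ?thesis by (simp add: add.commute)
        qed
        moreover have "\<bar>?g $ n * (2 / ((real n + 1) * (real n + 3)))\<bar> \<le> 8 * C / ((real n + 1) * a)"
        proof -
          have "\<bar>?g $ n * (2 / ((real n + 1) * (real n + 3)))\<bar>
              \<le> (4 * C * a) * (2 / ((real n + 1) * (real n + 1)))"
            unfolding abs_mult using gb[of n] C a(1)
            by (intro mult_mono) (auto simp: a_def intro!: divide_left_mono mult_left_mono)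
          also have "\<dots> = 8 * C / ((real n + 1) * a)"
            using a(1) unfolding a(2)[symmetric] by (simp add: field_simps)
          finally show ?thesis .
        qed
        moreover have "\<bar>f $ (n + 2) / real (n + 2 + 1)\<bar> \<le> C / ((real n + 1) * a)"
          using f'[of n 2] by (simp add: a_def)
        ultimately have "\<bar>prim c f $ Suc n + prim c f $ (Suc n + 2)\<bar>
            \<le> 8 * C / ((real n + 1) * a) + 2 * (C / ((real n + 1) * a))"
          by linarith
        also have "\<dots> = 10 * C / ((real n + 1) * a)" by (simp add: add_divide_distrib[symmetric])
        finally show "norm (prim c f $ Suc n + prim c f $ (Suc n + 2))
            \<le> 10 * C / ((real n + 1) * sqrt (real n + 1))" by (simp add: a_def)
      qed
      then show "summable (\<lambda>n. prim c f $ n + prim c f $ (n + 2))"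
        by (subst (asm) summable_Suc_iff[of "\<lambda>n. prim c f $ n + prim c f $ (n + 2)"])
    qed
  qed (use assms in simp)
qed

definition iter_val :: "form list \<Rightarrow> real" where
  "iter_val w = (\<Sum>n. iter_int w $ n)"

lemma summable_iter_int:
  assumes "hd w \<noteq> WP" "w \<noteq> []"
  shows "summable (\<lambda>n. iter_int w $ n)"
  using assms by (cases w) (auto intro: summable_prim[OF _ sqrt_decay_iter_int])

lemma iter_int_tendsto_iter_val:
  assumes "hd w \<noteq> WP" "w \<noteq> []"
  shows "(eval_fps (iter_int w) \<longlongrightarrow> iter_val w) (at_left 1)"
  using abel_limit[OF summable_iter_int[OF assms]] unfolding eval_fps_def iter_val_def .

text \<open>
  Holds for every word, including those that diverge at 1. Together with a simple zero of a second
  factor this makes the boundary terms in the proof of duality vanish.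
\<close>

lemma iter_int_weak_growth: "((\<lambda>x. (1 - x) * eval_fps (iter_int w) x) \<longlongrightarrow> 0) (at_left 1)"
  unfolding eval_fps_def
  by (rule abel_mean_tendsto[OF sqrt_decay_tendsto_0[OF sqrt_decay_iter_int]])

lemma conv_radius_iter_int: "fps_conv_radius (iter_int w) \<ge> 1"
proof -
  obtain K where K: "\<And>n. \<bar>iter_int w $ n\<bar> \<le> K"
    using convergent_real_bounded[OF sqrt_decay_tendsto_0[OF sqrt_decay_iter_int]] by blast
  show ?thesis unfolding fps_conv_radius_def
  proof (rule conv_radius_geI_ex)
    fix r :: real assume r: "0 < r" "ereal r < 1"
    have "summable (\<lambda>n. iter_int w $ n * r ^ n)"
      by (rule summable_comparison_test'[of "\<lambda>n. K * r ^ n" 0])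
         (use r K in \<open>auto simp: abs_mult power_abs intro!: mult_mono\<close>)
    then show "\<exists>z. norm z = r \<and> summable (\<lambda>n. iter_int w $ n * z ^ n)"
      using r by (intro exI[of _ r]) auto
  qed
qed

lemma norm_less_conv_radius_iter_int:
  fixes x :: real
  shows "\<bar>x\<bar> < 1 \<Longrightarrow> ereal (norm x) < fps_conv_radius (iter_int w)"
  by (rule less_le_trans[OF _ conv_radius_iter_int]) simp

section \<open>Duality\<close>

fun form_at :: "form \<Rightarrow> real \<Rightarrow> real" where
  "form_at W0 x = 1 / x"
| "form_at WP x = 2 / (1 - x\<^sup>2)"
| "form_at WM x = 2 / (1 + x\<^sup>2)"

abbreviation iter_fun :: "form list \<Rightarrow> real \<Rightarrow> real" where
  "iter_fun w \<equiv> eval_fps (iter_int w)"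

text \<open>
  The proviso excludes the one case in which \<open>form_mult W0\<close> drops a nonzero constant term.
\<close>

lemma eval_form_mult:
  assumes "0 < x" "x < 1" "c = W0 \<Longrightarrow> w \<noteq> []"
  shows "eval_fps (form_mult c (iter_int w)) x = form_at c x * iter_fun w x"
proof (cases "c = W0")
  case True
  have rad: "ereal (norm x) < fps_conv_radius (iter_int w)"
    using assms by (intro norm_less_conv_radius_iter_int) auto
  have "iter_int w $ 0 = 0" using True assms by (simp add: iter_int_nth_0)
  show ?thesis
  proof (cases "iter_int w = 0")
    case False
    then have "1 \<le> subdegree (iter_int w)"
      using \<open>iter_int w $ 0 = 0\<close> by (metis One_nat_def Suc_leI gr0I nth_subdegree_nonzero)
    then show ?thesis using True assms rad by (simp add: eval_fps_shift)
  qed (use True in simp)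
next
  case False
  let ?q = "1 - fps_const (form_sign c) * fps_X ^ 2 :: real fps" and ?g = "form_mult c (iter_int w)"
  have rad: "ereal (norm x) < fps_conv_radius (iter_int v)" for v
    using assms by (intro norm_less_conv_radius_iter_int) auto
  have radg: "ereal (norm x) < fps_conv_radius ?g"
    using less_le_trans[OF rad fps_conv_radius_deriv[of "iter_int (c # w)"]] by simp
  have radm: "fps_conv_radius (fps_const (form_sign c) * fps_X ^ 2 :: real fps) = \<infinity>"
    using fps_conv_radius_mult[of "fps_const (form_sign c)" "fps_X ^ 2 :: real fps"] by simp
  have radq: "fps_conv_radius ?q = \<infinity>"
    using fps_conv_radius_diff[of 1 "fps_const (form_sign c) * fps_X ^ 2 :: real fps"] radm by simp
  have "eval_fps ?q x = 1 - form_sign c * x\<^sup>2"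
    using radm by (simp add: eval_fps_diff eval_fps_mult)
  moreover have "eval_fps ?q x * eval_fps ?g x = eval_fps (?q * ?g) x"
    using radq radg by (intro eval_fps_mult[symmetric]) auto
  moreover have "eval_fps (?q * ?g) x = 2 * iter_fun w x"
    unfolding form_mult_clear_denominator[OF False] using rad by (simp add: eval_fps_mult)
  ultimately have "(1 - form_sign c * x\<^sup>2) * eval_fps ?g x = 2 * iter_fun w x"
    by simp
  moreover have "x\<^sup>2 < 1" using assms by (simp add: power_less_one_iff abs_square_less_1)
  then have "1 - form_sign c * x\<^sup>2 \<noteq> 0" "form_at c x = 2 / (1 - form_sign c * x\<^sup>2)"
    using False add_nonneg_eq_0_iff[of 1 "x\<^sup>2"] by (cases c; simp)+
  moreover have "Q * E = 2 * I \<Longrightarrow> Q \<noteq> 0 \<Longrightarrow> E = 2 / Q * I" for Q E I :: real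
    by (simp add: field_simps)
  ultimately show ?thesis by metis
qed

lemma iter_fun_deriv:
  assumes "0 < x" "x < 1" "c = W0 \<Longrightarrow> w \<noteq> []"
  shows "(iter_fun (c # w) has_field_derivative form_at c x * iter_fun w x) (at x)"
  using has_field_derivative_eval_fps[OF norm_less_conv_radius_iter_int, of x "c # w" UNIV]
    eval_form_mult[OF assms] assms by simp

fun form_dual :: "form \<Rightarrow> form" where
  "form_dual W0 = WP" | "form_dual WP = W0" | "form_dual WM = WM"

definition word_dual :: "form list \<Rightarrow> form list" where
  "word_dual w = map form_dual (rev w)"

lemma form_dual_dual [simp]: "form_dual (form_dual c) = c"
  by (cases c) auto

lemma word_dual_dual [simp]: "word_dual (word_dual w) = w"
  by (simp add: word_dual_def rev_map comp_def)

lemma word_dual_append: "word_dual (u @ v) = word_dual v @ word_dual u"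
  by (simp add: word_dual_def)

lemma word_dual_simps [simp]: "word_dual [] = []" "word_dual w = [] \<longleftrightarrow> w = []"
  "length (word_dual w) = length w"
  by (simp_all add: word_dual_def)

text \<open>
  The involution of the unit interval that reverses orientation and exchanges the forms
  \<open>dx/x\<close> and \<open>2dx/(1 - x\<^sup>2)\<close> up to sign.
\<close>

definition cayley :: "real \<Rightarrow> real" where "cayley x = (1 - x) / (1 + x)"

lemma cayley_bounds: "0 < x \<Longrightarrow> x < 1 \<Longrightarrow> 0 < cayley x" "0 < x \<Longrightarrow> x < 1 \<Longrightarrow> cayley x < 1"
  by (simp_all add: cayley_def)

lemma cayley_cayley: "0 < x \<Longrightarrow> x < 1 \<Longrightarrow> cayley (cayley x) = x"
  by (simp add: cayley_def field_simps)

lemma cayley_deriv: "0 < x \<Longrightarrow> (cayley has_field_derivative - 2 / (1 + x)\<^sup>2) (at x)"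
  unfolding cayley_def [abs_def]
  by (auto intro!: derivative_eq_intros simp: field_simps power2_eq_square)

lemma form_at_cayley:
  assumes "0 < x" "x < 1"
  shows "form_at (form_dual c) (cayley x) * (- 2 / (1 + x)\<^sup>2) = - form_at c x"
proof -
  have x2: "x\<^sup>2 < 1" using assms by (simp add: abs_square_less_1)
  have nz: "1 + x \<noteq> 0" "1 - x \<noteq> 0" "x \<noteq> 0" using assms by auto
  have "(1 + x)\<^sup>2 - (1 - x)\<^sup>2 = 4 * x" "(1 + x)\<^sup>2 + (1 - x)\<^sup>2 = 2 * (1 + x\<^sup>2)"
    by (simp_all add: power2_eq_square algebra_simps)
  then have e: "1 - (cayley x)\<^sup>2 = 4 * x / (1 + x)\<^sup>2" "1 + (cayley x)\<^sup>2 = 2 * (1 + x\<^sup>2) / (1 + x)\<^sup>2"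
    using nz by (simp_all add: cayley_def power_divide diff_divide_eq_iff add_divide_eq_iff)
  show ?thesis
  proof (cases c)
    case W0
    then show ?thesis using nz by (simp add: e)
  next
    case WP
    have "s / d * (- 2 / s\<^sup>2) = - (2 / (d * s))" if "s \<noteq> 0" "d \<noteq> 0" for s d :: real
      using that by (simp add: power2_eq_square)
    from this[of "1 + x" "1 - x"] have "(1 + x) / (1 - x) * (- 2 / (1 + x)\<^sup>2) = - (2 / (1 - x\<^sup>2))"
      using nz by (simp add: power2_eq_square algebra_simps)
    then show ?thesis by (simp add: WP cayley_def)
  next
    case WM
    have "2 / (2 * d / s) * (- 2 / s) = - (2 / d)" if "s \<noteq> 0" for s d :: real
      using that by simp
    from this[of "(1 + x)\<^sup>2" "1 + x\<^sup>2"] show ?thesis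
      unfolding WM form_dual.simps form_at.simps e(2) using nz by simp
  qed
qed

lemma filterlim_cayley_at_right_0: "filterlim cayley (at_left 1) (at_right 0)"
  and filterlim_cayley_at_left_1: "filterlim cayley (at_right 0) (at_left 1)"
  unfolding cayley_def [abs_def] by real_asymp+

text \<open>
  The part of the iterated integral of \<open>w\<close> over the unit interval in which exactly the outer \<open>i\<close>
  variables exceed \<open>x\<close>. The integral of the outer forms from \<open>x\<close> to 1 is
  moved by the Cayley substitution to an integral from 0 to \<open>cayley x\<close>.
\<close>

definition dual_term :: "form list \<Rightarrow> nat \<Rightarrow> real \<Rightarrow> real" where
  "dual_term w i x = iter_fun (drop i w) x * iter_fun (word_dual (take i w)) (cayley x)"

lemma telescope_sum:
  fixes a :: "nat \<Rightarrow> real"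
  shows "(\<Sum>i\<le>n. a i - (if i = 0 then 0 else a (i - 1))) = a n"
  by (induction n) auto

text \<open>
  The sum is the whole integral over the unit interval, cut at \<open>x\<close>, so it cannot depend on \<open>x\<close>.
  Concretely, moving the cut across the form at position \<open>i\<close> produces the same term \<open>a i\<close> with opposite signs
  from two neighbouring summands.
\<close>

lemma dual_sum_deriv:
  assumes w: "hd w \<noteq> WP" "last w \<noteq> W0" "w \<noteq> []" and x: "0 < x" "x < 1"
  shows "((\<lambda>x. \<Sum>i\<le>length w. dual_term w i x) has_field_derivative 0) (at x)"
proof -
  define a where "a i = (if i < length w then form_at (w ! i) x * iter_fun (drop (Suc i) w) x
      * iter_fun (word_dual (take i w)) (cayley x) else 0)" for i
  have fst_deriv: "(iter_fun (drop i w) has_field_derivative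
      (if i < length w then form_at (w ! i) x * iter_fun (drop (Suc i) w) x else 0)) (at x)" for i
  proof (cases "i < length w")
    case True
    have "w ! i = W0 \<Longrightarrow> drop (Suc i) w \<noteq> []"
    proof
      assume c: "w ! i = W0" and "drop (Suc i) w = []"
      then have "i = length w - 1" using True by simp
      then show False using c w by (simp add: last_conv_nth)
    qed
    then show ?thesis
      using iter_fun_deriv[OF x, of "w ! i" "drop (Suc i) w"] True
      by (simp add: Cons_nth_drop_Suc)
  qed (simp add: eval_fps_1[abs_def])
  have snd_deriv: "((\<lambda>x. iter_fun (word_dual (take i w)) (cayley x)) has_field_derivative
      (if i = 0 then 0 else - form_at (w ! (i - 1)) x * iter_fun (word_dual (take (i - 1) w)) (cayley x))) (at x)"
    if "i \<le> length w" for i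
  proof (cases i)
    case (Suc j)
    have split: "take i w = take j w @ [w ! j]"
      using Suc that by (simp add: take_Suc_conv_app_nth)
    have wd: "word_dual (take i w) = form_dual (w ! j) # word_dual (take j w)"
      unfolding split by (simp add: word_dual_def)
    have "form_dual (w ! j) = W0 \<Longrightarrow> word_dual (take j w) \<noteq> []"
      using w by (cases "w ! j"; cases j) (auto simp: hd_conv_nth)
    then have "(iter_fun (word_dual (take i w)) has_field_derivative
        form_at (form_dual (w ! j)) (cayley x) * iter_fun (word_dual (take j w)) (cayley x)) (at (cayley x))"
      unfolding wd by (intro iter_fun_deriv) (use x cayley_bounds in auto)
    from DERIV_chain2[OF this cayley_deriv[OF x(1)]]
    have "((\<lambda>x. iter_fun (word_dual (take i w)) (cayley x)) has_field_derivative
        form_at (form_dual (w ! j)) (cayley x) * (- 2 / (1 + x)\<^sup>2) * iter_fun (word_dual (take j w)) (cayley x)) (at x)"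
      by (simp only: mult_ac)
    then show ?thesis unfolding form_at_cayley[OF x] by (simp add: Suc)
  qed (simp add: eval_fps_1[abs_def])
  have "(dual_term w i has_field_derivative a i - (if i = 0 then 0 else a (i - 1))) (at x)"
    if "i \<le> length w" for i
  proof (cases i)
    case 0
    show ?thesis unfolding dual_term_def [abs_def]
      by (rule DERIV_cong[OF DERIV_mult[OF fst_deriv snd_deriv[OF that]]]) (simp add: 0 a_def)
  next
    case (Suc j)
    show ?thesis unfolding dual_term_def [abs_def]
      by (rule DERIV_cong[OF DERIV_mult[OF fst_deriv snd_deriv[OF that]]])
         (use that in \<open>simp add: Suc a_def algebra_simps\<close>)
  qed
  then have "((\<lambda>x. \<Sum>i\<le>length w. dual_term w i x) has_field_derivative
      (\<Sum>i\<le>length w. a i - (if i = 0 then 0 else a (i - 1)))) (at x)"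
    by (intro DERIV_sum) auto
  then show ?thesis unfolding telescope_sum by (simp add: a_def)
qed

text \<open>
  The first factor has a simple zero at 0, and the second one, evaluated near 1, grows more slowly
  than \<open>1/x\<close>.
\<close>

lemma dual_term_tendsto_0:
  assumes "i < length w"
  shows "(dual_term w i \<longlongrightarrow> 0) (at_right 0)"
proof -
  let ?u = "drop i w" and ?v = "word_dual (take i w)"
  have "?u \<noteq> []" using assms by simp
  then have 0: "iter_fun ?u 0 = 0" by (simp add: eval_fps_at_0 iter_int_nth_0)
  have "(iter_fun ?u has_field_derivative eval_fps (fps_deriv (iter_int ?u)) 0) (at 0 within {0<..})"
    by (rule has_field_derivative_eval_fps[OF norm_less_conv_radius_iter_int]) simp
  then have lim1: "((\<lambda>x. iter_fun ?u x / x) \<longlongrightarrow> eval_fps (fps_deriv (iter_int ?u)) 0) (at_right 0)"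
    by (simp add: has_field_derivative_iff 0)
  have lim2: "((\<lambda>x. (1 - cayley x) * iter_fun ?v (cayley x)) \<longlongrightarrow> 0) (at_right 0)"
    by (rule filterlim_compose[OF iter_int_weak_growth filterlim_cayley_at_right_0])
  have lim3: "((\<lambda>x. (1 + x) / 2) \<longlongrightarrow> (1 + 0) / 2) (at_right (0 :: real))"
    by (intro tendsto_intros) auto
  \<comment> \<open>The middle factor compensates \<open>1 - cayley x = 2 * x / (1 + x)\<close>.\<close>
  have "((\<lambda>x. (iter_fun ?u x / x) * ((1 + x) / 2) * ((1 - cayley x) * iter_fun ?v (cayley x)))
      \<longlongrightarrow> eval_fps (fps_deriv (iter_int ?u)) 0 * ((1 + 0) / 2) * 0) (at_right 0)"
    by (intro tendsto_mult lim1 lim2 lim3)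
  moreover have ev: "eventually (\<lambda>x. dual_term w i x
      = (iter_fun ?u x / x) * ((1 + x) / 2) * ((1 - cayley x) * iter_fun ?v (cayley x))) (at_right 0)"
    using eventually_at_right_real[of 0 "1::real", OF zero_less_one]
  proof eventually_elim
    case (elim x)
    then have "1 - cayley x = 2 * x / (1 + x)" by (simp add: cayley_def field_simps)
    then show ?case using elim by (simp add: dual_term_def)
  qed
  ultimately show ?thesis unfolding tendsto_cong[OF ev] by simp
qed

lemma dual_sum_tendsto:
  assumes "last w \<noteq> W0" "w \<noteq> []"
  shows "((\<lambda>x. \<Sum>i\<le>length w. dual_term w i x) \<longlongrightarrow> iter_val (word_dual w)) (at_right 0)"
proof -
  have "form_dual (last w) \<noteq> WP" using assms(1) by (cases "last w") auto
  then have hd: "hd (word_dual w) \<noteq> WP"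
    using assms(2) by (simp add: word_dual_def hd_map hd_rev)
  have "(dual_term w (length w) \<longlongrightarrow> iter_val (word_dual w)) (at_right 0)"
    unfolding dual_term_def [abs_def] using assms(2) hd
    by (simp add: filterlim_compose[OF iter_int_tendsto_iter_val filterlim_cayley_at_right_0])
  then have "((\<lambda>x. (\<Sum>i<length w. dual_term w i x) + dual_term w (length w) x)
      \<longlongrightarrow> (\<Sum>i<length w. 0) + iter_val (word_dual w)) (at_right 0)"
    by (intro tendsto_add tendsto_sum dual_term_tendsto_0) auto
  then show ?thesis by (simp add: lessThan_Suc_atMost[symmetric])
qed

text \<open>
  Reflecting the cut interval; this reduces the limit at 1 to the limit at 0 for the dual word.
\<close>

lemma dual_sum_flip:
  assumes "0 < x" "x < 1"
  shows "(\<Sum>i\<le>length w. dual_term w i x) = (\<Sum>i\<le>length w. dual_term (word_dual w) i (cayley x))"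
proof -
  have "dual_term w (length w - i) x = dual_term (word_dual w) i (cayley x)" if "i \<le> length w" for i
    using that assms
    by (simp add: dual_term_def cayley_cayley word_dual_def take_map drop_map take_rev drop_rev rev_map
        comp_def mult.commute)
  then have "(\<Sum>i\<le>length w. dual_term (word_dual w) i (cayley x))
      = (\<Sum>i\<le>length w. dual_term w (length w - i) x)"
    by (intro sum.cong) auto
  also have "\<dots> = (\<Sum>i\<le>length w. dual_term w i x)"
    using sum.nat_diff_reindex[of "\<lambda>i. dual_term w i x" "Suc (length w)"]
    by (simp add: lessThan_Suc_atMost)
  finally show ?thesis by simp
qed

text \<open>
  The constant sum of \<open>dual_term\<close> tends to the value of the dual word at 0 and to the value of the word
  itself at 1. The hypotheses say that the integral of \<open>w\<close> converges at both ends.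
\<close>

lemma iter_val_dual:
  assumes "hd w \<noteq> WP" "last w \<noteq> W0" "w \<noteq> []"
  shows "iter_val (word_dual w) = iter_val w"
proof -
  let ?H = "\<lambda>x. \<Sum>i\<le>length w. dual_term w i x"
  have "\<exists>c. \<forall>x\<in>{0<..<1}. ?H x = c"
  proof (rule has_field_derivative_zero_constant)
    show "(?H has_field_derivative 0) (at x within {0<..<1})" if "x \<in> {0<..<1}" for x
      by (rule has_field_derivative_at_within[OF dual_sum_deriv[OF assms]]) (use that in auto)
  qed simp
  then obtain c where c: "\<And>x. x \<in> {0<..<1} \<Longrightarrow> ?H x = c" by blast
  have ev: "eventually (\<lambda>x. ?H x = c) (at_right 0)" "eventually (\<lambda>x. ?H x = c) (at_left 1)"
    using eventually_mono[OF eventually_at_right_real[of 0 "1::real", OF zero_less_one] c]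
      eventually_mono[OF eventually_at_left_real[of 0 "1::real", OF zero_less_one] c] by auto
  have "(?H \<longlongrightarrow> iter_val (word_dual w)) (at_right 0)"
    by (rule dual_sum_tendsto) (use assms in auto)
  then have 1: "iter_val (word_dual w) = c"
    unfolding tendsto_cong[OF ev(1)] by (auto simp: tendsto_const_iff)
  have "form_dual (hd w) \<noteq> W0" using assms(1) by (cases "hd w") auto
  then have "last (word_dual w) \<noteq> W0"
    using assms(3) by (simp add: word_dual_def last_map last_rev)
  from filterlim_compose[OF dual_sum_tendsto[OF this] filterlim_cayley_at_left_1]
  have "((\<lambda>x. \<Sum>i\<le>length w. dual_term (word_dual w) i (cayley x)) \<longlongrightarrow> iter_val w) (at_left 1)"
    using assms(3) by simp
  moreover have ev': "eventually (\<lambda>x. (\<Sum>i\<le>length w. dual_term (word_dual w) i (cayley x)) = ?H x) (at_left 1)"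
    using eventually_at_left_real[of 0 "1::real", OF zero_less_one]
    by eventually_elim (rule dual_sum_flip[symmetric], auto)
  ultimately have "(?H \<longlongrightarrow> iter_val w) (at_left 1)" by (simp only: tendsto_cong[OF ev'])
  then have "iter_val w = c" unfolding tendsto_cong[OF ev(2)] by (auto simp: tendsto_const_iff)
  with 1 show ?thesis by simp
qed

section \<open>Integration by parts\<close>

text \<open>
  The class of series for which evaluation at 1 as a limit is a ring homomorphism. It lets identities
  between formal power series be read off at 1 although the series converge there only conditionally.
\<close>

definition has_abel_value :: "real fps \<Rightarrow> real \<Rightarrow> bool" where
  "has_abel_value f L \<longleftrightarrow> fps_conv_radius f \<ge> 1 \<and> (eval_fps f \<longlongrightarrow> L) (at_left 1)"

lemma has_abel_value_unique: "has_abel_value f L \<Longrightarrow> has_abel_value f L' \<Longrightarrow> L = L'"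
  unfolding has_abel_value_def by (auto intro: tendsto_unique[rotated])

lemma has_abel_value_transfer:
  assumes "has_abel_value f L" "has_abel_value g L'"
    and "fps_conv_radius h \<ge> min (fps_conv_radius f) (fps_conv_radius g)"
    and "\<And>x :: real. ereal (norm x) < fps_conv_radius f \<Longrightarrow> ereal (norm x) < fps_conv_radius g \<Longrightarrow>
           eval_fps h x = op (eval_fps f x) (eval_fps g x)"
    and "((\<lambda>x. op (eval_fps f x) (eval_fps g x)) \<longlongrightarrow> M) (at_left 1)"
  shows "has_abel_value h M"
proof -
  have "fps_conv_radius h \<ge> 1"
    using assms unfolding has_abel_value_def by (meson min.boundedI order.trans)
  moreover have ev: "eventually (\<lambda>x. eval_fps h x = op (eval_fps f x) (eval_fps g x)) (at_left 1)"
    using eventually_at_left_real[of 0 "1::real", OF zero_less_one]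
  proof eventually_elim
    case (elim x)
    then have x: "ereal (norm x) < 1" by simp
    have "ereal (norm x) < fps_conv_radius f" "ereal (norm x) < fps_conv_radius g"
      using less_le_trans[OF x] assms(1,2) unfolding has_abel_value_def by blast+
    then show ?case by (rule assms(4))
  qed
  ultimately show ?thesis using assms(5) unfolding has_abel_value_def tendsto_cong[OF ev] by simp
qed

lemma has_abel_value_add:
  assumes f: "has_abel_value f L" and g: "has_abel_value g L'"
  shows "has_abel_value (f + g) (L + L')"
  by (rule has_abel_value_transfer[OF f g, where op = "(+)"])
     (use f g in \<open>auto simp: eval_fps_add fps_conv_radius_add has_abel_value_def intro: tendsto_add\<close>)

lemma has_abel_value_mult:
  assumes f: "has_abel_value f L" and g: "has_abel_value g L'"
  shows "has_abel_value (f * g) (L * L')"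
  by (rule has_abel_value_transfer[OF f g, where op = "(*)"])
     (use f g in \<open>auto simp: eval_fps_mult fps_conv_radius_mult has_abel_value_def intro: tendsto_mult\<close>)

lemma has_abel_value_const: "has_abel_value (fps_const c) c"
  by (simp add: has_abel_value_def eval_fps_const[abs_def])

lemma has_abel_value_sum:
  assumes "\<And>i. i \<in> A \<Longrightarrow> has_abel_value (f i) (L i)"
  shows "has_abel_value (\<Sum>i\<in>A. f i) (\<Sum>i\<in>A. L i)"
  using assms
proof (induction A rule: infinite_finite_induct)
  case (insert i A)
  then show ?case by (simp add: has_abel_value_add)
qed (use has_abel_value_const[of 0] in auto)

lemma has_abel_value_iter_int:
  assumes "hd w \<noteq> WP" "w \<noteq> []"
  shows "has_abel_value (iter_int w) (iter_val w)"
  using iter_int_tendsto_iter_val[OF assms] conv_radius_iter_int by (simp add: has_abel_value_def)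

text \<open>
  Each application of the product rule moves one form \<open>dx/x\<close> from the first factor to the second one,
  with a change of sign. It stops when the first factor is the primitive of the bare form \<open>WM\<close>.
\<close>

lemma prim_W0_by_parts:
  fixes n m :: nat and v :: "form list"
  defines "F \<equiv> \<lambda>j. iter_int (replicate j W0 @ [WM])"
    and "G \<equiv> \<lambda>j. iter_int (replicate j W0 @ WM # v)"
  shows "prim W0 (F n * G m)
    = (\<Sum>j\<le>n. fps_const ((-1) ^ (n - j)) * (F j * G (m + 1 + (n - j))))
      + fps_const ((-1) ^ (n + 1)) * prim WM (G (m + 1 + n))"
proof (induction n arbitrary: m)
  case 0
  have "F 0 * G (m + 1) = prim WM (G (m + 1)) + prim W0 (F 0 * G m)"
    using prim_mult_prim[of WM 1 W0 "G m"] by (simp add: F_def G_def iter_int_nth_0)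
  then show ?case by (simp flip: fps_const_neg)
next
  case (Suc n)
  have "F (Suc n) * G (m + 1) = prim W0 (F n * G (m + 1)) + prim W0 (F (Suc n) * G m)"
    using prim_mult_prim[of W0 "F n" W0 "G m"] by (simp add: F_def G_def iter_int_nth_0)
  then have "prim W0 (F (Suc n) * G m) = F (Suc n) * G (m + 1) - prim W0 (F n * G (m + 1))"
    by simp
  also have "prim W0 (F n * G (m + 1))
      = (\<Sum>j\<le>n. fps_const ((-1) ^ (n - j)) * (F j * G (m + 1 + (Suc n - j))))
        + fps_const ((-1) ^ (n + 1)) * prim WM (G (m + 1 + Suc n))"
    unfolding Suc by (auto simp: Suc_diff_le intro!: sum.cong)
  also have "(\<Sum>j\<le>n. fps_const ((-1) ^ (n - j)) * (F j * G (m + 1 + (Suc n - j))))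
      = - (\<Sum>j\<le>n. fps_const ((-1) ^ (Suc n - j)) * (F j * G (m + 1 + (Suc n - j))))"
    by (auto simp: Suc_diff_le sum_negf[symmetric] simp flip: fps_const_neg intro!: sum.cong)
  finally show ?case by (simp flip: fps_const_neg)
qed

lemma prim_WM_by_parts:
  fixes n :: nat and v :: "form list"
  defines "F \<equiv> \<lambda>j. iter_int (replicate j W0 @ [WM])"
    and "G \<equiv> \<lambda>j. iter_int (replicate j W0 @ WM # v)"
  shows "prim WM (F n * iter_int v)
    = (\<Sum>j\<le>n. fps_const ((-1) ^ (n - j)) * (F j * G (n - j)))
      + fps_const ((-1) ^ (n + 1)) * prim WM (G n)"
proof (cases n)
  case 0
  have "F 0 * G 0 = prim WM (G 0) + prim WM (F 0 * iter_int v)"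
    using prim_mult_prim[of WM 1 WM "iter_int v"] by (simp add: F_def G_def)
  then show ?thesis by (simp add: 0 flip: fps_const_neg)
next
  case (Suc l)
  have "F n * G 0 = prim W0 (F l * G 0) + prim WM (F n * iter_int v)"
    using prim_mult_prim[of W0 "F l" WM "iter_int v"] by (simp add: F_def G_def Suc iter_int_nth_0)
  then have "prim WM (F n * iter_int v) = F n * G 0 - prim W0 (F l * G 0)" by simp
  also have "prim W0 (F l * G 0)
      = (\<Sum>j\<le>l. fps_const ((-1) ^ (l - j)) * (F j * G (n - j)))
        + fps_const ((-1) ^ (l + 1)) * prim WM (G n)"
    unfolding F_def G_def prim_W0_by_parts Suc by (auto simp: Suc_diff_le intro!: sum.cong)
  also have "(\<Sum>j\<le>l. fps_const ((-1) ^ (l - j)) * (F j * G (n - j)))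
      = - (\<Sum>j\<le>l. fps_const ((-1) ^ (n - j)) * (F j * G (n - j)))"
    unfolding Suc
    by (auto simp: Suc_diff_le sum_negf[symmetric] simp flip: fps_const_neg intro!: sum.cong)
  finally show ?thesis by (simp add: Suc flip: fps_const_neg)
qed

text \<open>
  The core of the identity. The shuffle product turns the left-hand side into one
  integral of a product, and integration by parts expands that integral.
\<close>

lemma sum_iter_val_shuffles:
  fixes n :: nat and v :: "form list"
  assumes "regular v" "set v \<inter> {W0, WM} = {}"
  shows "(\<Sum>u \<in> shuffles (replicate n W0 @ [WM]) v. iter_val (WM # u))
    = (\<Sum>j\<le>n. (-1) ^ (n - j) *
         (iter_val (replicate j W0 @ [WM]) * iter_val (replicate (n - j) W0 @ WM # v)))
      + (-1) ^ (n + 1) * iter_val (WM # replicate n W0 @ WM # v)"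
proof (rule has_abel_value_unique)
  let ?S = "\<Sum>u \<in> shuffles (replicate n W0 @ [WM]) v. iter_int (WM # u)"
  have hd: "hd (replicate j W0 @ WM # w) \<noteq> WP" for j w by (cases j) auto
  show "has_abel_value ?S (\<Sum>u \<in> shuffles (replicate n W0 @ [WM]) v. iter_val (WM # u))"
    by (intro has_abel_value_sum has_abel_value_iter_int) auto
  have "?S = prim WM (iter_int (replicate n W0 @ [WM]) * iter_int v)"
    using assms by (subst iter_int_shuffle) (auto simp: prim_sum)
  also have "\<dots> = (\<Sum>j\<le>n. fps_const ((-1) ^ (n - j)) *
         (iter_int (replicate j W0 @ [WM]) * iter_int (replicate (n - j) W0 @ WM # v)))
      + fps_const ((-1) ^ (n + 1)) * iter_int (WM # replicate n W0 @ WM # v)"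
    unfolding prim_WM_by_parts by simp
  finally show "has_abel_value ?S ((\<Sum>j\<le>n. (-1) ^ (n - j) *
         (iter_val (replicate j W0 @ [WM]) * iter_val (replicate (n - j) W0 @ WM # v)))
      + (-1) ^ (n + 1) * iter_val (WM # replicate n W0 @ WM # v))"
    by (simp only:)
       (intro has_abel_value_add has_abel_value_sum has_abel_value_mult has_abel_value_const has_abel_value_iter_int hd; simp)
qed

section \<open>T-values as iterated integrals\<close>

text \<open>
  The part of the multiple sum with largest index \<open>n\<close>, for the argument list read from its last
  entry. The value at the empty list makes 0 the largest index of the empty sum, so that the recursion
  starts with 1.
\<close>

fun summand :: "(nat \<times> int) list \<Rightarrow> nat \<Rightarrow> real" where
  "summand [] n = (if n = 0 then 1 else 0)"
| "summand ((k, \<sigma>) # rs) n =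
     2 * real_of_int \<sigma> ^ n / (2 * real n - real (Suc (length rs))) ^ k * (\<Sum>i<n. summand rs i)"

lemma summand_eq_0: "n < length rs \<Longrightarrow> summand rs n = 0"
  by (induction rs arbitrary: n) (auto intro!: sum.neutral)

lemma finite_incr_indices: "finite (incr_indices r N)"
  by (rule finite_subset[OF _ finite_lists_length_eq[of "{1..N}" r]]) (auto simp: incr_indices_def)

lemma incr_indices_Suc:
  "incr_indices (Suc r) N = (\<lambda>(n, ms). ms @ [n]) ` (SIGMA n:{1..N}. incr_indices r (n - 1))"
proof (intro set_eqI iffI)
  fix ns assume ns: "ns \<in> incr_indices (Suc r) N"
  then have "ns \<noteq> []" by (auto simp: incr_indices_def)
  then obtain ms n where msn: "ns = ms @ [n]" by (metis rev_exhaust)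
  have "n \<in> {1..N}" "ms \<in> incr_indices r (n - 1)"
    using ns by (force simp: incr_indices_def msn sorted_wrt_append)+
  then show "ns \<in> (\<lambda>(n, ms). ms @ [n]) ` (SIGMA n:{1..N}. incr_indices r (n - 1))"
    by (force simp: msn)
next
  fix ns assume "ns \<in> (\<lambda>(n, ms). ms @ [n]) ` (SIGMA n:{1..N}. incr_indices r (n - 1))"
  then show "ns \<in> incr_indices (Suc r) N"
    by (force simp: incr_indices_def sorted_wrt_append)
qed

lemma T_partial_snoc:
  "T_partial (ks @ [(k, \<sigma>)]) N =
    (\<Sum>n=1..N. 2 * real_of_int \<sigma> ^ n / (2 * real n - real (Suc (length ks))) ^ k * T_partial ks (n - 1))"
proof -
  define r where "r = length ks"
  let ?g = "\<lambda>ks ns i. real_of_int (snd (ks ! i)) ^ (ns ! i) / (2 * real (ns ! i) - real (i + 1)) ^ fst (ks ! i)"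
  let ?h = "\<lambda>n. real_of_int \<sigma> ^ n / (2 * real n - real (Suc r)) ^ k"
  have inj: "inj_on (\<lambda>(n, ms). ms @ [n]) (SIGMA n:{1..N}. incr_indices r (n - 1))"
    by (auto simp: inj_on_def)
  have prod: "(\<Prod>i<Suc r. ?g (ks @ [(k, \<sigma>)]) (ms @ [n]) i) = ?h n * (\<Prod>i<r. ?g ks ms i)"
    if "ms \<in> incr_indices r (n - 1)" for ms n
  proof -
    have len: "length ms = r" using that by (simp add: incr_indices_def)
    have "(\<Prod>i<r. ?g (ks @ [(k, \<sigma>)]) (ms @ [n]) i) = (\<Prod>i<r. ?g ks ms i)"
      by (intro prod.cong) (auto simp: nth_append len r_def)
    moreover have "(ms @ [n]) ! r = n" "(ks @ [(k, \<sigma>)]) ! r = (k, \<sigma>)"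
      using nth_append_length[of ms n "[]"] nth_append_length[of ks "(k, \<sigma>)" "[]"] len
      by (simp_all add: r_def)
    ultimately show ?thesis by (simp add: add.commute mult.commute)
  qed
  have "T_partial (ks @ [(k, \<sigma>)]) N
      = 2 ^ Suc r * (\<Sum>(n, ms) \<in> (SIGMA n:{1..N}. incr_indices r (n - 1)).
          (\<Prod>i<Suc r. ?g (ks @ [(k, \<sigma>)]) (ms @ [n]) i))"
    unfolding T_partial_def length_append_singleton r_def[symmetric] incr_indices_Suc sum.reindex[OF inj]
    by (simp only: comp_def case_prod_unfold)
  also have "(\<Sum>(n, ms) \<in> (SIGMA n:{1..N}. incr_indices r (n - 1)).
        (\<Prod>i<Suc r. ?g (ks @ [(k, \<sigma>)]) (ms @ [n]) i))
      = (\<Sum>n=1..N. \<Sum>ms \<in> incr_indices r (n - 1). \<Prod>i<Suc r. ?g (ks @ [(k, \<sigma>)]) (ms @ [n]) i)"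
    by (rule sum.Sigma[symmetric]) (auto simp: finite_incr_indices)
  also have "\<dots> = (\<Sum>n=1..N. \<Sum>ms \<in> incr_indices r (n - 1). ?h n * (\<Prod>i<r. ?g ks ms i))"
    by (intro sum.cong refl prod)
  also have "2 ^ Suc r * \<dots> = (\<Sum>n=1..N. 2 * ?h n * T_partial ks (n - 1))"
    by (simp add: T_partial_def r_def sum_distrib_left mult_ac)
  finally show ?thesis by (simp add: r_def)
qed

lemma T_partial_eq_sum_summand: "T_partial ks N = (\<Sum>n\<le>N. summand (rev ks) n)"
proof (induction ks arbitrary: N rule: rev_induct)
  case Nil
  have "incr_indices 0 N = {[]}" by (auto simp: incr_indices_def)
  then show ?case by (simp add: T_partial_def)
next
  case (snoc x ks)
  obtain k \<sigma> where x: "x = (k, \<sigma>)" by force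
  have "T_partial ks (n - 1) = (\<Sum>i<n. summand (rev ks) i)" if "n \<ge> 1" for n
    using that unfolding snoc by (cases n) (auto simp: lessThan_Suc_atMost)
  then have "T_partial (ks @ [x]) N = (\<Sum>n=1..N. summand (rev (ks @ [x])) n)"
    unfolding x T_partial_snoc by (intro sum.cong) auto
  also have "\<dots> = (\<Sum>n\<le>N. summand (rev (ks @ [x])) n)"
    by (rule sum.mono_neutral_left) (auto simp: x not_less_eq_eq)
  finally show ?case .
qed

definition form_of :: "int \<Rightarrow> form" where
  "form_of \<sigma> = (if \<sigma> = 1 then WP else WM)"

text \<open>
  Reads an argument list from its last entry. The sign \<open>\<tau>\<close> is the product of the signs
  already read: summing the geometric series over the largest index leaves the factor
  \<open>\<sigma>\<close> to the power of the next index, which multiplies the next sign by \<open>\<sigma>\<close>.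
\<close>

fun T_word :: "int \<Rightarrow> (nat \<times> int) list \<Rightarrow> form list" where
  "T_word \<tau> [] = []"
| "T_word \<tau> ((k, \<sigma>) # rs) = replicate (k - 1) W0 @ form_of (\<tau> * \<sigma>) # T_word (\<tau> * \<sigma>) rs"

text \<open>
  The form \<open>WM\<close> is \<open>2dx/(1 + x\<^sup>2)\<close>, whereas the summation produces \<open>2\<sigma>dx/(1 - \<sigma>x\<^sup>2)\<close>; the factors
  \<open>\<sigma>\<close> are collected here.
\<close>

fun T_sign :: "int \<Rightarrow> (nat \<times> int) list \<Rightarrow> real" where
  "T_sign \<tau> [] = 1"
| "T_sign \<tau> ((k, \<sigma>) # rs) = of_int (\<tau> * \<sigma>) * T_sign (\<tau> * \<sigma>) rs"

definition admissible_entries :: "(nat \<times> int) list \<Rightarrow> bool" where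
  "admissible_entries ks \<longleftrightarrow> (\<forall>(k, \<sigma>) \<in> set ks. k \<ge> 1 \<and> (\<sigma> = 1 \<or> \<sigma> = -1))"

lemma iter_int_replicate_W0_nth:
  assumes "w \<noteq> []"
  shows "iter_int (replicate l W0 @ w) $ m = iter_int w $ m / real m ^ l"
proof (induction l)
  case (Suc l)
  have "prim W0 f $ m = f $ m / real m" if "f $ 0 = 0" for f
    using that by (cases m) (auto simp: prim_nth_Suc add.commute)
  then show ?case using Suc assms by (simp add: iter_int_nth_0)
qed simp

text \<open>
  The largest index \<open>n\<close> of a sum of depth \<open>r\<close> belongs to the exponent \<open>2n - r\<close>. With \<open>n = r + j\<close> that
  exponent is \<open>r + 2j\<close>, and the indices below \<open>r\<close>, which contribute nothing, disappear from the statement.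
\<close>

lemma iter_int_T_word_nth:
  assumes "admissible_entries rs" "\<tau> = 1 \<or> \<tau> = -1"
  shows "iter_int (T_word \<tau> rs) $ (length rs + 2 * j)
           = T_sign \<tau> rs * of_int \<tau> ^ (length rs + j) * summand rs (length rs + j)"
    and "(\<And>j. m \<noteq> length rs + 2 * j) \<Longrightarrow> iter_int (T_word \<tau> rs) $ m = 0"
  using assms
proof (induction rs arbitrary: \<tau> j m)
  case Nil
  {
    case 1
    then show ?case by simp
  next
    case 2
    then have "m \<noteq> 0" by (metis add_0 list.size(3) mult_0_right)
    then show ?case by simp
  }
next
  case (Cons x rs)
  obtain k \<sigma> where x: "x = (k, \<sigma>)" by force
  define r where "r = length rs"
  have IH: "iter_int (T_word c rs) $ (r + 2 * j) = T_sign c rs * of_int c ^ (r + j) * summand rs (r + j)"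
     "(\<And>j. m \<noteq> r + 2 * j) \<Longrightarrow> iter_int (T_word c rs) $ m = 0"
     if "c = 1 \<or> c = -1" "admissible_entries (x # rs)" for c j m
    using Cons.IH[where \<tau> = c] that by (auto simp: admissible_entries_def r_def)
  have main: "form_mult (form_of c) (iter_int (T_word c rs)) $ (r + 2 * j)
        = 2 * T_sign c rs * of_int c ^ (r + j) * (\<Sum>i<Suc (r + j). summand rs i)" (is "?A j")
     and zero: "(\<And>j. m \<noteq> r + 2 * j) \<Longrightarrow> form_mult (form_of c) (iter_int (T_word c rs)) $ m = 0"
     if c: "c = 1 \<or> c = -1" and adm: "admissible_entries (x # rs)" for c j m
  proof -
    let ?f = "iter_int (T_word c rs)" and ?w = "form_of c"
    have w: "?w \<noteq> W0" "form_sign ?w = of_int c" using c by (auto simp: form_of_def)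
    note rec = form_mult_nth_rec[OF w(1), of ?f, unfolded w(2)]
    show z: "form_mult ?w ?f $ m = 0" if "\<And>j. m \<noteq> r + 2 * j" for m
      using that
    proof (induction m rule: induct_nat_012)
      case (ge2 m)
      have "m \<noteq> r + 2 * j" for j using ge2.prems[of "Suc j"] by auto
      then show ?case using ge2 IH(2)[OF c adm, of "Suc (Suc m)"] by (simp add: rec)
    qed (use IH(2)[OF c adm] in \<open>simp_all add: rec\<close>)
    \<comment> \<open>The recursion multiplies by \<open>c\<close> and adds one more summand, as does the partial sum.\<close>
    show "?A j"
    proof (induction j)
      case 0
      have "(\<Sum>i<r. summand rs i) = 0" by (intro sum.neutral) (auto simp: summand_eq_0 r_def)
      moreover have "form_mult ?w ?f $ r = 2 * ?f $ r"
      proof -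
        consider "r = 0" | "r = Suc 0" | n where "r = Suc (Suc n)" by (metis not0_implies_Suc)
        then show ?thesis
        proof cases
          case (3 n)
          have "n \<noteq> r + 2 * j" for j using 3 by simp
          then have "form_mult ?w ?f $ n = 0" by (rule z)
          then show ?thesis using 3 by (simp add: rec)
        qed (simp_all add: rec)
      qed
      ultimately show ?case using IH(1)[OF c adm, of 0] by simp
    next
      case (Suc j)
      have "form_mult ?w ?f $ (r + 2 * Suc j) = of_int c * form_mult ?w ?f $ (r + 2 * j) + 2 * ?f $ (r + 2 * Suc j)"
        using rec(3)[of "r + 2 * j"] by simp
      then show ?case unfolding Suc IH(1)[OF c adm, of "Suc j"] by (simp add: algebra_simps)
    qed
  qed
  have word: "iter_int (T_word \<tau> (x # rs)) $ m
      = iter_int (form_of (\<tau> * \<sigma>) # T_word (\<tau> * \<sigma>) rs) $ m / real m ^ (k - 1)" for \<tau> m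
    by (simp add: x iter_int_replicate_W0_nth del: iter_int.simps)
  {
    case 1
    let ?c = "\<tau> * \<sigma>"
    from 1 have c: "?c = 1 \<or> ?c = -1" and k: "k \<ge> 1"
      by (auto simp: x admissible_entries_def)
    have "of_int c * of_int c = (1 :: real)" if "c = 1 \<or> c = -1" for c :: int using that by auto
    note cc = this[OF c]
    define S where "S = (\<Sum>i<Suc (r + j). summand rs i)"
    define D where "D = real (Suc (r + 2 * j))"
    have "iter_int (T_word \<tau> (x # rs)) $ (length (x # rs) + 2 * j)
        = 2 * T_sign ?c rs * of_int ?c ^ (r + j) * S / D / D ^ (k - 1)"
      unfolding word by (simp add: prim_nth_Suc main[OF c 1(1)] S_def D_def r_def[symmetric] add.commute)
    also have "\<dots> = 2 * T_sign ?c rs * of_int ?c ^ (r + j) * S / D ^ k"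
      using k by (cases k) auto
    also have "\<dots> = of_int ?c * of_int ?c * (2 * T_sign ?c rs * of_int ?c ^ (r + j) * S / D ^ k)"
      unfolding cc by simp
    also have "\<dots> = T_sign \<tau> (x # rs) * of_int \<tau> ^ (length (x # rs) + j) * summand (x # rs) (length (x # rs) + j)"
      by (simp add: x r_def[symmetric] S_def D_def power_mult_distrib mult_ac)
    finally show ?case .
  next
    case 2
    let ?c = "\<tau> * \<sigma>"
    from 2 have c: "?c = 1 \<or> ?c = -1" by (auto simp: x admissible_entries_def)
    show ?case
    proof (cases m)
      case (Suc n)
      have "n \<noteq> r + 2 * j" for j using 2(1)[of j] Suc by (auto simp: r_def)
      then show ?thesis unfolding word using zero[OF c 2(2)] Suc by (simp add: prim_nth_Suc)
    qed (simp add: word)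
  }
qed

text \<open>
  Up to the sign both sides are sums of the same numbers: deleting the vanishing coefficients from the
  power series at 1 leaves the summands of the T-value. The condition on the outermost form guarantees convergence.
\<close>

lemma T_val_eq_iter_val:
  assumes "admissible_entries ks" "ks \<noteq> []" "hd (T_word 1 (rev ks)) \<noteq> WP"
  shows "T_val ks = T_sign 1 (rev ks) * iter_val (T_word 1 (rev ks))"
proof -
  let ?rs = "rev ks"
  define r where "r = length ?rs"
  define \<epsilon> where "\<epsilon> = T_sign 1 ?rs"
  have adm: "admissible_entries ?rs" using assms(1) by (simp add: admissible_entries_def)
  have "T_sign \<tau> rs * T_sign \<tau> rs = 1" if "admissible_entries rs" "\<tau> = 1 \<or> \<tau> = -1" for \<tau> rs
    using that by (induction \<tau> rs rule: T_sign.induct) (auto simp: admissible_entries_def)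
  then have \<epsilon>: "\<epsilon> * \<epsilon> = 1" using adm by (simp add: \<epsilon>_def)
  have ne: "T_word 1 ?rs \<noteq> []" using assms(2) by (cases "?rs") auto
  have "(\<lambda>m. iter_int (T_word 1 ?rs) $ m) sums iter_val (T_word 1 ?rs)"
    unfolding iter_val_def by (rule summable_sums[OF summable_iter_int[OF assms(3) ne]])
  then have "(\<lambda>j. iter_int (T_word 1 ?rs) $ (r + 2 * j)) sums iter_val (T_word 1 ?rs)"
    by (subst sums_mono_reindex)
       (auto simp: strict_mono_def r_def intro!: iter_int_T_word_nth(2)[OF adm])
  then have "(\<lambda>j. \<epsilon> * summand ?rs (r + j)) sums iter_val (T_word 1 ?rs)"
    by (simp only: r_def \<epsilon>_def iter_int_T_word_nth(1)[OF adm disjI1[OF refl]] of_int_1 power_one mult_1_right)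
  then have "(\<lambda>j. \<epsilon> * (\<epsilon> * summand ?rs (r + j))) sums (\<epsilon> * iter_val (T_word 1 ?rs))"
    by (rule sums_mult)
  then have "(\<lambda>j. summand ?rs (j + r)) sums (\<epsilon> * iter_val (T_word 1 ?rs))"
    by (simp add: mult.assoc[symmetric] \<epsilon> add.commute)
  then have "summand ?rs sums (\<epsilon> * iter_val (T_word 1 ?rs) + (\<Sum>n<r. summand ?rs n))"
    by (subst (asm) sums_iff_shift) 
  moreover have "(\<Sum>n<r. summand ?rs n) = 0"
    by (intro sum.neutral) (auto simp: summand_eq_0 r_def)
  ultimately have "summand ?rs sums (\<epsilon> * iter_val (T_word 1 ?rs))" by simp
  then have "T_partial ks \<longlonglongrightarrow> \<epsilon> * iter_val (T_word 1 ?rs)"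
    unfolding T_partial_eq_sum_summand[abs_def] by (simp add: sums_def_le)
  then show ?thesis by (simp add: T_val_def \<epsilon>_def limI)
qed

section \<open>Compositions and shuffles\<close>

lemma finite_compositions: "finite (compositions m w)"
proof (rule finite_subset)
  show "compositions m w \<subseteq> {js. set js \<subseteq> {..w} \<and> length js = m}"
    by (auto simp: compositions_def dest: member_le_sum_list)
qed (rule finite_lists_length_eq, simp)

text \<open>
  Whether the first part is 1 or larger corresponds, in \<open>sum_compositions_fill_gaps\<close>, to whether the first letter
  of a shuffle comes from \<open>cs\<close> or is one of the inserted letters.
\<close>

lemma compositions_Suc_Suc:
  "compositions (Suc m) (Suc w)
    = (#) 1 ` compositions m w \<union> (\<lambda>js. Suc (hd js) # tl js) ` compositions (Suc m) w"
proof (intro set_eqI iffI)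
  fix js assume js: "js \<in> compositions (Suc m) (Suc w)"
  then obtain i l where i: "js = i # l" by (cases js) (auto simp: compositions_def)
  show "js \<in> (#) 1 ` compositions m w \<union> (\<lambda>js. Suc (hd js) # tl js) ` compositions (Suc m) w"
  proof (cases "i = 1")
    case True
    then show ?thesis using js by (auto simp: i compositions_def)
  next
    case False
    then have "js = Suc (hd ((i - 1) # l)) # tl ((i - 1) # l)" "(i - 1) # l \<in> compositions (Suc m) w"
      using js by (auto simp: i compositions_def)
    then show ?thesis by blast
  qed
next
  fix js assume "js \<in> (#) 1 ` compositions m w \<union> (\<lambda>js. Suc (hd js) # tl js) ` compositions (Suc m) w"
  then show "js \<in> compositions (Suc m) (Suc w)"
  proof
    assume "js \<in> (\<lambda>js. Suc (hd js) # tl js) ` compositions (Suc m) w"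
    then obtain l where l: "js = Suc (hd l) # tl l" "l \<in> compositions (Suc m) w" by blast
    then show ?thesis by (cases l) (auto simp: compositions_def)
  qed (auto simp: compositions_def)
qed

lemma sum_compositions_Suc_Suc:
  "(\<Sum>js \<in> compositions (Suc m) (Suc w). h js)
    = (\<Sum>js \<in> compositions m w. h (1 # js)) + (\<Sum>js \<in> compositions (Suc m) w. h (Suc (hd js) # tl js))"
proof -
  have inj: "inj_on (\<lambda>js. Suc (hd js) # tl js) (compositions (Suc m) w)"
  proof (rule inj_onI)
    fix a b assume "a \<in> compositions (Suc m) w" "b \<in> compositions (Suc m) w"
      "Suc (hd a) # tl a = Suc (hd b) # tl b"
    then show "a = b" by (cases a; cases b) (auto simp: compositions_def)
  qed
  have "1 \<le> hd js" if "js \<in> compositions (Suc m) w" for js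
    using that by (cases js) (auto simp: compositions_def)
  then have "(#) 1 ` compositions m w \<inter> (\<lambda>js. Suc (hd js) # tl js) ` compositions (Suc m) w = {}"
    by fastforce
  then show ?thesis
    unfolding compositions_Suc_Suc
    by (subst sum.union_disjoint) (auto simp: finite_compositions sum.reindex[OF inj] sum.reindex)
qed

lemma compositions_eq_empty: "w < m \<Longrightarrow> compositions m w = {}"
proof -
  have "length js \<le> sum_list js" if "\<forall>j \<in> set js. 1 \<le> j" for js :: "nat list"
    using that by (induction js) auto
  then show "w < m \<Longrightarrow> compositions m w = {}" by (fastforce simp: compositions_def)
qed

lemma compositions_1: "compositions (Suc 0) (Suc w) = {[Suc w]}"
  by (auto simp: compositions_def length_Suc_conv)

text \<open>
  The parts of the composition, each diminished by 1, count the letters \<open>WP\<close> before, between and after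
  the letters of \<open>cs\<close>; a list \<open>cs\<close> of length \<open>m\<close> needs \<open>m + 1\<close> parts.
\<close>

fun fill_gaps :: "form list \<Rightarrow> nat list \<Rightarrow> form list" where
  "fill_gaps cs [] = []"
| "fill_gaps [] (j # js) = replicate (j - 1) WP"
| "fill_gaps (c # cs) (j # js) = replicate (j - 1) WP @ c # fill_gaps cs js"

text \<open>
  A shuffle of \<open>cs\<close> with copies of a letter that does not occur in \<open>cs\<close> is determined by the sizes of the gaps, and
  these are arbitrary.
\<close>

lemma sum_compositions_fill_gaps:
  assumes "WP \<notin> set cs"
  shows "(\<Sum>js \<in> compositions (Suc (length cs)) (Suc (length cs) + p). h (fill_gaps cs js))
    = (\<Sum>u \<in> shuffles cs (replicate p WP). h u)"
  using assms
proof (induction cs arbitrary: p h)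
  case Nil
  then show ?case by (simp add: compositions_1)
next
  case (Cons c cs)
  let ?n = "Suc (length cs)"
  have c: "c \<noteq> WP" using Cons.prems by auto
  have head: "(\<Sum>js \<in> compositions ?n (?n + p). h (fill_gaps (c # cs) (1 # js)))
      = (\<Sum>u \<in> (#) c ` shuffles cs (replicate p WP). h u)" for p and h :: "form list \<Rightarrow> 'a"
    using Cons.IH[of "\<lambda>u. h (c # u)" p] Cons.prems by (simp add: sum.reindex)
  show ?case
  proof (induction p arbitrary: h)
    case 0
    have "(\<Sum>js \<in> compositions (Suc ?n) (Suc ?n). h (fill_gaps (c # cs) js))
        = (\<Sum>js \<in> compositions ?n ?n. h (fill_gaps (c # cs) (1 # js)))"
      by (subst sum_compositions_Suc_Suc) (simp add: compositions_eq_empty)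
    then show ?case using head[of h 0] by simp
  next
    case (Suc p)
    have "(\<Sum>js \<in> compositions (Suc ?n) (Suc ?n + p). h (fill_gaps (c # cs) (Suc (hd js) # tl js)))
        = (\<Sum>js \<in> compositions (Suc ?n) (Suc ?n + p). h (WP # fill_gaps (c # cs) js))"
    proof (intro sum.cong refl)
      fix js assume "js \<in> compositions (Suc ?n) (Suc ?n + p)"
      then obtain j js' where "js = Suc j # js'"
        by (cases js; cases "hd js") (auto simp: compositions_def)
      then show "h (fill_gaps (c # cs) (Suc (hd js) # tl js)) = h (WP # fill_gaps (c # cs) js)"
        by simp
    qed
    also have "\<dots> = (\<Sum>u \<in> (#) WP ` shuffles (c # cs) (replicate p WP). h u)"
      using Suc[of "\<lambda>u. h (WP # u)"] by (simp add: sum.reindex)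
    finally have "(\<Sum>js \<in> compositions (Suc ?n) (Suc (Suc ?n + p)). h (fill_gaps (c # cs) js))
        = (\<Sum>u \<in> (#) c ` shuffles cs (replicate (Suc p) WP). h u)
          + (\<Sum>u \<in> (#) WP ` shuffles (c # cs) (replicate p WP). h u)"
      using head[of h "Suc p"] by (simp add: sum_compositions_Suc_Suc)
    also have "\<dots> = (\<Sum>u \<in> shuffles (c # cs) (replicate (Suc p) WP). h u)"
      unfolding replicate_Suc shuffles.simps
      by (rule sum.union_disjoint[symmetric]) (use c in auto)
    finally show ?case by simp
  qed
qed

lemma fill_gaps_replicate_W0:
  "fill_gaps (replicate (length ms) W0 @ cs) (ms @ js)
    = concat (map (\<lambda>j. replicate (j - 1) WP @ [W0]) ms) @ fill_gaps cs js"
  by (induction ms) auto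

lemma T_word_plain:
  "T_word 1 (map plain ms @ rs) = concat (map (\<lambda>j. replicate (j - 1) W0 @ [WP]) ms) @ T_word 1 rs"
  by (induction ms) (auto simp: form_of_def)

lemma T_sign_plain: "T_sign 1 (map plain ms @ rs) = T_sign 1 rs"
  by (induction ms) auto

lemma word_dual_concat: "word_dual (concat ws) = concat (map word_dual (rev ws))"
  by (induction ws) (auto simp: word_dual_append)

lemma word_dual_replicate [simp]:
  "word_dual (replicate n c) = replicate n (form_dual c)" "word_dual [c] = [form_dual c]"
  by (simp_all add: word_dual_def)

lemma word_dual_Cons: "word_dual (c # w) = word_dual w @ [form_dual c]"
  by (simp add: word_dual_def)

text \<open>
  Dualising puts the separating letter in front of each block, reading the arguments of a T-value
  puts it behind.
\<close>

lemma concat_shift_separator: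
  "c # concat (map (\<lambda>j. R j @ [c]) ms) = concat (map (\<lambda>j. c # R j) ms) @ [c]"
  by (induction ms) auto

lemma T_word_eq_word_dual:
  assumes "1 \<le> a" "1 \<le> b" "1 \<le> c"
  shows "T_word 1 (rev ([barred a] @ map plain ms @ [barred b, barred c]))
    = word_dual (WM # fill_gaps (replicate (Suc (length ms)) W0 @ [WM]) ([a] @ ms @ [b, c]))"
proof -
  let ?Z = "\<lambda>j. replicate (j - 1) W0"
  have "fill_gaps (replicate (Suc (length ms)) W0 @ [WM]) ([a] @ ms @ [b, c])
      = replicate (a - 1) WP @ [W0] @ concat (map (\<lambda>j. replicate (j - 1) WP @ [W0]) ms)
        @ replicate (b - 1) WP @ [WM] @ replicate (c - 1) WP"
    by (simp add: fill_gaps_replicate_W0)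
  then have "word_dual (WM # fill_gaps (replicate (Suc (length ms)) W0 @ [WM]) ([a] @ ms @ [b, c]))
      = ?Z c @ [WM] @ ?Z b @ (concat (map (\<lambda>j. WP # ?Z j) (rev ms)) @ [WP]) @ ?Z a @ [WM]"
    by (simp only:)
       (simp add: word_dual_append word_dual_concat word_dual_Cons rev_map comp_def)
  also have "\<dots> = ?Z c @ WM # ?Z b @ (WP # concat (map (\<lambda>j. ?Z j @ [WP]) (rev ms))) @ ?Z a @ [WM]"
    unfolding concat_shift_separator by simp
  also have "\<dots> = T_word 1 (rev ([barred a] @ map plain ms @ [barred b, barred c]))"
    using T_word_plain[of "rev ms" "[barred a]"] by (simp add: rev_map form_of_def)
  finally show ?thesis ..
qed

text \<open>
  The cumulative signs of this pattern, read from the last entry, are \<open>-, +, \<dots>, +, -\<close>: two factors \<open>-1\<close>, hence no sign in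
  front. This covers every summand on the left-hand side and also the first term on the right.
\<close>

lemma T_val_barred_plain_barred_barred:
  assumes "1 \<le> a" "1 \<le> b" "1 \<le> c" "\<forall>j \<in> set ms. 1 \<le> j"
  shows "T_val ([barred a] @ map plain ms @ [barred b, barred c])
    = iter_val (WM # fill_gaps (replicate (Suc (length ms)) W0 @ [WM]) ([a] @ ms @ [b, c]))"
proof -
  let ?ks = "[barred a] @ map plain ms @ [barred b, barred c]"
  let ?w = "WM # fill_gaps (replicate (Suc (length ms)) W0 @ [WM]) ([a] @ ms @ [b, c])"
  have "admissible_entries ?ks" using assms by (auto simp: admissible_entries_def)
  moreover have "hd (T_word 1 (rev ?ks)) \<noteq> WP"
    by (cases "c - 1") (auto simp: form_of_def)
  moreover have "T_sign 1 (rev ?ks) = 1"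
    using T_sign_plain[of "rev ms" "[barred a]"] by (simp add: rev_map)
  ultimately have "T_val ?ks = iter_val (word_dual ?w)"
    using T_val_eq_iter_val[of ?ks] by (simp only: T_word_eq_word_dual[OF assms(1-3)]) simp
  also have "last ?w \<noteq> W0" by (auto simp: fill_gaps_replicate_W0)
  then have "iter_val (word_dual ?w) = iter_val ?w" by (intro iter_val_dual) auto
  finally show ?thesis .
qed

lemma T_val_barred:
  assumes "1 \<le> j"
  shows "T_val [barred j] = - iter_val (replicate (j - 1) W0 @ [WM])"
proof -
  have "hd (T_word 1 (rev [barred j])) \<noteq> WP" by (cases "j - 1") (auto simp: form_of_def)
  then show ?thesis
    using T_val_eq_iter_val[of "[barred j]"] assms
    by (simp add: admissible_entries_def form_of_def)
qed

lemma T_val_plain_ones_barred_barred: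
  assumes "1 \<le> m"
  shows "T_val ((if p = 0 then [] else replicate (p - 1) (plain 1) @ [barred 1]) @ [barred m])
    = - iter_val (replicate (m - 1) W0 @ WM # replicate p WP)"
proof (cases p)
  case 0
  then show ?thesis using T_val_barred[OF assms] by simp
next
  case (Suc q)
  let ?ks = "replicate q (plain 1) @ [barred 1] @ [barred m]"
  have "hd (T_word 1 (rev ?ks)) \<noteq> WP" by (cases "m - 1") (auto simp: form_of_def)
  moreover have "T_word 1 (replicate q (plain 1)) = replicate q WP" "T_sign 1 (replicate q (plain 1)) = 1"
    by (induction q) (auto simp: form_of_def)
  ultimately show ?thesis
    using T_val_eq_iter_val[of ?ks] assms
    by (auto simp: Suc admissible_entries_def form_of_def)
qed

theorem corollary1p2p4:
  fixes k p :: nat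
  assumes "k \<ge> 2"
  shows
    "(\<Sum>js \<in> compositions (k + 1) (p + k + 1).
        T_val ([barred (js ! 0)] @ map (\<lambda>i. plain (js ! i)) [1..<k - 1]
               @ [barred (js ! (k - 1)), barred (js ! k)]))
     = (- 1) ^ k * T_val ([barred 1] @ replicate (k - 2) (plain 1) @ [barred 1, barred (p + 1)])
       + (- 1) ^ k *
         (\<Sum>j = 1..k. (- 1) ^ j * T_val [barred j] *
            T_val ((if p = 0 then [] else replicate (p - 1) (plain 1) @ [barred 1])
                   @ [barred (k - j + 1)]))"
proof -
  define n where "n = k - 1"
  have k: "k = Suc n" "n \<ge> 1" using assms by (auto simp: n_def)
  let ?cs = "replicate n W0 @ [WM]"
  define X where "X j = iter_val (replicate j W0 @ [WM])" for j
  define Y where "Y j = iter_val (replicate j W0 @ WM # replicate p WP)" for j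
  have summand_eq: "T_val ([barred (js ! 0)] @ map (\<lambda>i. plain (js ! i)) [1..<k - 1]
               @ [barred (js ! (k - 1)), barred (js ! k)]) = iter_val (WM # fill_gaps ?cs js)"
    if js: "js \<in> compositions (k + 1) (p + k + 1)" for js
  proof -
    have len: "length js = Suc (Suc n)" using js by (simp add: compositions_def k)
    define a ms b c where "a = js ! 0" and "ms = map ((!) js) [1..<n]" and "b = js ! n" and "c = js ! Suc n"
    have "js = map ((!) js) ([0] @ [1..<n] @ [n, Suc n])"
    proof -
      have "[0..<Suc (Suc n)] = [0] @ [1..<n] @ [n, Suc n]"
        using k(2) by (simp add: upt_rec[of 0])
      then show ?thesis using map_nth[of js] len by (metis (no_types))
    qed
    then have split: "js = [a] @ ms @ [b, c]" by (simp add: a_def ms_def b_def c_def)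
    have pos: "\<forall>j \<in> set js. 1 \<le> j" using js by (simp add: compositions_def)
    have n: "n = Suc (length ms)" using k(2) by (simp add: ms_def)
    have "[barred (js ! 0)] @ map (\<lambda>i. plain (js ! i)) [1..<k - 1] @ [barred (js ! (k - 1)), barred (js ! k)]
        = [barred a] @ map plain ms @ [barred b, barred c]"
      by (simp add: a_def b_def c_def ms_def k)
    moreover have "1 \<le> a" "1 \<le> b" "1 \<le> c" "\<forall>j \<in> set ms. 1 \<le> j"
      using pos unfolding split by auto
    ultimately show ?thesis
      using T_val_barred_plain_barred_barred[of a b c ms] by (simp only: n split[symmetric])
  qed
  have "(\<Sum>js \<in> compositions (k + 1) (p + k + 1).
        T_val ([barred (js ! 0)] @ map (\<lambda>i. plain (js ! i)) [1..<k - 1]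
               @ [barred (js ! (k - 1)), barred (js ! k)]))
      = (\<Sum>js \<in> compositions (Suc (length ?cs)) (Suc (length ?cs) + p). iter_val (WM # fill_gaps ?cs js))"
    using summand_eq by (intro sum.cong) (auto simp: k add.commute)
  also have "\<dots> = (\<Sum>u \<in> shuffles ?cs (replicate p WP). iter_val (WM # u))"
    by (rule sum_compositions_fill_gaps) auto
  also have "\<dots> = (\<Sum>j\<le>n. (-1) ^ (n - j) * (X j * Y (n - j)))
      + (-1) ^ (n + 1) * iter_val (WM # replicate n W0 @ WM # replicate p WP)"
    unfolding X_def Y_def by (rule sum_iter_val_shuffles) auto
  also have "iter_val (WM # replicate n W0 @ WM # replicate p WP)
      = T_val ([barred 1] @ replicate (k - 2) (plain 1) @ [barred 1, barred (p + 1)])"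
  proof -
    define q where "q = k - 2"
    have n: "n = Suc q" using k by (simp add: q_def)
    have "concat (replicate q [W0]) = replicate q W0" by (induction q) auto
    then show ?thesis
      using T_val_barred_plain_barred_barred[of 1 1 "p + 1" "replicate q 1"]
        fill_gaps_replicate_W0[of "replicate q 1" "[WM]" "[1, Suc p]"]
      by (simp add: n q_def[symmetric])
  qed
  also have "(\<Sum>j\<le>n. (-1) ^ (n - j) * (X j * Y (n - j)))
      = (-1) ^ k * (\<Sum>j = 1..k. (- 1) ^ j * T_val [barred j] *
            T_val ((if p = 0 then [] else replicate (p - 1) (plain 1) @ [barred 1])
                   @ [barred (k - j + 1)]))"
  proof -
    have "(\<Sum>j\<le>n. (-1) ^ (n - j) * (X j * Y (n - j)))
        = (\<Sum>j = 1..k. (-1) ^ (k - j) * (X (j - 1) * Y (k - j)))"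
      by (rule sum.reindex_bij_witness[of _ "\<lambda>j. j - 1" Suc]) (auto simp: k)
    also have "\<dots> = (\<Sum>j = 1..k. (-1) ^ k * ((- 1) ^ j * T_val [barred j] *
            T_val ((if p = 0 then [] else replicate (p - 1) (plain 1) @ [barred 1])
                   @ [barred (k - j + 1)])))"
    proof (intro sum.cong refl)
      fix j assume "j \<in> {1..k}"
      then have j: "1 \<le> j" "j \<le> k" by auto
      have "(-1 :: real) ^ (k - j) = (-1) ^ k * (-1) ^ j"
        using j by (simp add: minus_one_power_iff)
      then show "(-1) ^ (k - j) * (X (j - 1) * Y (k - j)) = (-1) ^ k * ((- 1) ^ j * T_val [barred j] *
            T_val ((if p = 0 then [] else replicate (p - 1) (plain 1) @ [barred 1])
                   @ [barred (k - j + 1)]))"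
        unfolding T_val_barred[OF j(1)] T_val_plain_ones_barred_barred[OF le_add2]
        by (simp add: X_def Y_def)
    qed
    finally show ?thesis by (simp only: sum_distrib_left)
  qed
  finally show ?thesis by (simp only: k Suc_eq_plus1 add.commute)
qed

end
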